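(* Let $K$ be a field of characteristic zero, $x=(x_1,\dots,x_n)$, $y=(y_1,\dots,y_n)$, $z=(z_1,\dots,z_n)$, let $F\in K[x]^n$ be a Keller map and let $d\ge 2$ be an integer. Consider the maps (a) $G=(F-y^{*d},\ y)$, (b) $G=(F-y^{*d},\ y,\ z+y^{*d})$, (c) $G=(F-y^{*d},\ z-d\,x* y^{*(d-1)},\ y)=(F,0,\dots,0,0,\dots,0)+\nabla_{x,y,z}\big(y^{\mathsf T}z-x^{\mathsf T}y^{*d}\big)$. For each of them, every $K$-linear combination of the components of $G$ and $1$ which is reducible is already a scalar multiple of $1$. Furthermore, $G$ is a Keller map, and $F$ is invertible if and only if $G$ is invertible. Additionally: i) if $F-x$ is linearly conjugate to a power linear map of degree $d$, then so is $G-(x,y,z)$ for $G$ in (b); ii) if $\mathcal{J}F$ is symmetric, then so is $\mathcal{J}_{x,y,z}G$ for $G$ in (c).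
   Context: $*$ denotes the Hadamard (componentwise) product and $v^{*d}$ the componentwise $d$-th power, so $y^{*d}=(y_1^d,\dots,y_n^d)$. $\mathcal{J}$ denotes the Jacobian matrix and $\nabla$ the gradient with respect to the indicated variables. A Keller map is a polynomial map in $m$ variables with $m$ components whose Jacobian determinant lies in $K^{*}$. A map $P$ is linearly conjugate to $Q$ if $Q=TP(T^{-1}\cdot)$ for an invertible matrix $T$. A power linear map of degree $d$ is a map of the form $(Av)^{*d}$ with $A$ a square matrix over $K$ and $v$ the vector of variables. *)

theory Defs
  imports "HOL-Library.Poly_Mapping" "Jordan_Normal_Form.Determinant"
begin

section \<open>Multivariate polynomials over K in the variables X_0, X_1, ... \<close>

text \<open>A polynomial is a finitely supported map from monomials (finitely supported
exponent vectors nat =>0 nat) to coefficients. This is a comm_ring_1.\<close>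

type_synonym 'a mpoly = "(nat \<Rightarrow>\<^sub>0 nat) \<Rightarrow>\<^sub>0 'a"

definition Var :: "nat \<Rightarrow> 'a::comm_ring_1 mpoly" where
  "Var i = Poly_Mapping.single (Poly_Mapping.single i 1) 1"

definition Const :: "'a::comm_ring_1 \<Rightarrow> 'a mpoly" where
  "Const c = Poly_Mapping.single 0 c"

text \<open>Variables occurring in a polynomial.\<close>
definition vars :: "'a::comm_ring_1 mpoly \<Rightarrow> nat set" where
  "vars p = (\<Union>m\<in>Poly_Mapping.keys p. Poly_Mapping.keys m)"

text \<open>Formal partial derivative with respect to X_j.\<close>
definition pderiv_mp :: "nat \<Rightarrow> 'a::comm_ring_1 mpoly \<Rightarrow> 'a mpoly" where
  "pderiv_mp j p = (\<Sum>m\<in>Poly_Mapping.keys p.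
      Poly_Mapping.single (m - Poly_Mapping.single j 1)
        (of_nat (Poly_Mapping.lookup m j) * Poly_Mapping.lookup p m))"

text \<open>Substitution X_i := s i (composition of polynomial maps).\<close>
definition subst_mp :: "(nat \<Rightarrow> 'a::comm_ring_1 mpoly) \<Rightarrow> 'a mpoly \<Rightarrow> 'a mpoly" where
  "subst_mp s p = (\<Sum>m\<in>Poly_Mapping.keys p.
      Const (Poly_Mapping.lookup p m) *
      (\<Prod>i\<in>Poly_Mapping.keys m. s i ^ Poly_Mapping.lookup m i))"

section \<open>Polynomial maps K^m -> K^m (components indexed by 0..m-1)\<close>

definition polymap :: "nat \<Rightarrow> (nat \<Rightarrow> 'a::comm_ring_1 mpoly) \<Rightarrow> bool" where
  "polymap m F \<longleftrightarrow> (\<forall>i<m. vars (F i) \<subseteq> {..<m})"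

definition jacobian :: "nat \<Rightarrow> (nat \<Rightarrow> 'a::comm_ring_1 mpoly) \<Rightarrow> 'a mpoly mat" where
  "jacobian m F = mat m m (\<lambda>(i, j). pderiv_mp j (F i))"

text \<open>Keller map: polynomial map whose Jacobian determinant lies in K^*.\<close>
definition keller :: "nat \<Rightarrow> (nat \<Rightarrow> 'a::field mpoly) \<Rightarrow> bool" where
  "keller m F \<longleftrightarrow> polymap m F \<and> (\<exists>c. c \<noteq> 0 \<and> det (jacobian m F) = Const c)"

text \<open>Invertible: has a polynomial inverse map.\<close>
definition invertible_pm :: "nat \<Rightarrow> (nat \<Rightarrow> 'a::comm_ring_1 mpoly) \<Rightarrow> bool" where
  "invertible_pm m F \<longleftrightarrow> polymap m F \<and>
     (\<exists>H. polymap m H \<and> (\<forall>i<m. subst_mp H (F i) = Var i) \<and> (\<forall>i<m. subst_mp F (H i) = Var i))"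

text \<open>Power linear map of degree d: (A v)^{*d}.\<close>
definition power_linear :: "nat \<Rightarrow> nat \<Rightarrow> (nat \<Rightarrow> 'a::comm_ring_1 mpoly) \<Rightarrow> bool" where
  "power_linear m d P \<longleftrightarrow> (\<exists>A \<in> carrier_mat m m.
      \<forall>i<m. P i = (\<Sum>j<m. Const (A $$ (i, j)) * Var j) ^ d)"

text \<open>Q = T P(T^{-1} .) for an invertible matrix T (Ti is the inverse of T).\<close>
definition lin_conj :: "nat \<Rightarrow> (nat \<Rightarrow> 'a::comm_ring_1 mpoly) \<Rightarrow> (nat \<Rightarrow> 'a mpoly) \<Rightarrow> bool" where
  "lin_conj m P Q \<longleftrightarrow> (\<exists>T \<in> carrier_mat m m. \<exists>Ti \<in> carrier_mat m m.
      T * Ti = 1\<^sub>m m \<and> Ti * T = 1\<^sub>m m \<and>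
      (\<forall>i<m. Q i = (\<Sum>j<m. Const (T $$ (i, j)) *
          subst_mp (\<lambda>k. if k < m then (\<Sum>l<m. Const (Ti $$ (k, l)) * Var l) else Var k) (P j))))"

text \<open>Every K-linear combination of the components of G and 1 that is reducible
 (i.e. not irreducible) is a scalar multiple of 1.\<close>
definition lincomb_prop :: "nat \<Rightarrow> (nat \<Rightarrow> 'a::field mpoly) \<Rightarrow> bool" where
  "lincomb_prop m G \<longleftrightarrow> (\<forall>(c::'a) (lam::nat \<Rightarrow> 'a).
      \<not> irreducible (Const c + (\<Sum>i<m. Const (lam i) * G i)) \<longrightarrow>
      (\<exists>a. Const c + (\<Sum>i<m. Const (lam i) * G i) = Const a))"

section \<open>The three constructions.
  Variables: x_k = X_k, y_k = X_(n+k), z_k = X_(2n+k) for k < n.\<close>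

definition G_a :: "nat \<Rightarrow> nat \<Rightarrow> (nat \<Rightarrow> 'a::comm_ring_1 mpoly) \<Rightarrow> nat \<Rightarrow> 'a mpoly" where
  "G_a n d F i = (if i < n then F i - Var (n + i) ^ d else Var i)"

definition G_b :: "nat \<Rightarrow> nat \<Rightarrow> (nat \<Rightarrow> 'a::comm_ring_1 mpoly) \<Rightarrow> nat \<Rightarrow> 'a mpoly" where
  "G_b n d F i = (if i < n then F i - Var (n + i) ^ d
                  else if i < 2 * n then Var i
                  else Var i + Var (i - n) ^ d)"

definition G_c :: "nat \<Rightarrow> nat \<Rightarrow> (nat \<Rightarrow> 'a::comm_ring_1 mpoly) \<Rightarrow> nat \<Rightarrow> 'a mpoly" where
  "G_c n d F i = (if i < n then F i - Var (n + i) ^ d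
                  else if i < 2 * n then Var (n + i) - of_nat d * Var (i - n) * Var i ^ (d - 1)
                  else Var (i - n))"

end

theory Submission
  imports Defs
begin

text \<open>
  A linear combination of the components of $G$ and $1$ that has a constant non-zero partial
  derivative is irreducible. Otherwise it has the form $p = f(x) + r(y)$, where the gradient of $f$
  generates the unit ideal and $r$ has a constant leading coefficient in some $y_k$. Suppose
  $p = gh$. Then $g$ divides $\partial_i f\,\partial_j g - \partial_j f\,\partial_i g$, which has
  smaller degree in $y_k$ than $g$ and therefore vanishes; hence $\nabla_x g = w \nabla_x f$, and
  likewise $\nabla_x h = v \nabla_x f$. If $w$ and $v$ were both non-zero, then $g$ and $h$ would each
  have at least the degree of $f$ in some $x_j$, which is impossible for the factors of $p$. So one
  of them, say $g$, has $\nabla_x g = 0$, and then $\nabla f = g \nabla_x h$ makes $g$ a unit.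

  Each map $G$ is obtained from $(F, y)$ or $(F, y, z)$ by composing with polynomial automorphisms,
  which preserves invertibility and, by the chain rule, the Keller condition. If
  $F - x = T^{-1}(ATx)^{*d}$, then in the coordinates $(T(x + z), y, z)$ the map $G - (x,y,z)$ of (b)
  becomes $((A(x' - Tz))^{*d}, 0, y^{*d})$.
\<close>

section \<open>Evaluation of multivariate polynomials\<close>

text \<open>The coefficients pass through an arbitrary ring homomorphism \<open>h\<close>, so that
  one proof of multiplicativity serves both \<open>subst_mp\<close> (\<open>h = Const\<close>) and
  the univariate view \<open>uni\<close>.\<close>

definition ev :: "('a::comm_ring_1 \<Rightarrow> 'b::comm_ring_1) \<Rightarrow> (nat \<Rightarrow> 'b) \<Rightarrow> 'a mpoly \<Rightarrow> 'b" where
  "ev h s p = (\<Sum>m\<in>Poly_Mapping.keys p.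
      h (Poly_Mapping.lookup p m) * (\<Prod>i\<in>Poly_Mapping.keys m. s i ^ Poly_Mapping.lookup m i))"

lemma subst_mp_eq_ev: "subst_mp s = ev Const s"
  by (simp add: fun_eq_iff subst_mp_def ev_def)

lemma sum_keys_superset:
  fixes p :: "'k \<Rightarrow>\<^sub>0 'a::zero"
  assumes "\<And>m. h m 0 = (0::'b::comm_monoid_add)" "finite S" "Poly_Mapping.keys p \<subseteq> S"
  shows "(\<Sum>m\<in>Poly_Mapping.keys p. h m (Poly_Mapping.lookup p m)) = (\<Sum>m\<in>S. h m (Poly_Mapping.lookup p m))"
  using assms by (intro sum.mono_neutral_left) (auto simp: in_keys_iff)

text \<open>Terms may cancel in \<open>p + q\<close>, so all three sums are extended to the union of
  the supports of \<open>p\<close> and \<open>q\<close>, which \<open>h m 0 = 0\<close>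
  allows.\<close>

lemma sum_keys_add:
  fixes p q :: "'k \<Rightarrow>\<^sub>0 'a::comm_monoid_add"
  assumes "\<And>m. h m 0 = (0::'b::comm_monoid_add)" "\<And>m a b. h m (a + b) = h m a + h m b"
  shows "(\<Sum>m\<in>Poly_Mapping.keys (p + q). h m (Poly_Mapping.lookup (p + q) m)) =
    (\<Sum>m\<in>Poly_Mapping.keys p. h m (Poly_Mapping.lookup p m)) + (\<Sum>m\<in>Poly_Mapping.keys q. h m (Poly_Mapping.lookup q m))"
proof -
  let ?S = "Poly_Mapping.keys p \<union> Poly_Mapping.keys q"
  have S: "finite ?S" "Poly_Mapping.keys p \<subseteq> ?S" "Poly_Mapping.keys q \<subseteq> ?S" "Poly_Mapping.keys (p + q) \<subseteq> ?S"
    using keys_add[of p q] by auto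
  show ?thesis
    using sum_keys_superset[where h=h, OF assms(1) S(1,2)] sum_keys_superset[where h=h, OF assms(1) S(1,3)]
      sum_keys_superset[where h=h, OF assms(1) S(1,4)]
    by (simp add: lookup_add assms(2) sum.distrib)
qed

lemma poly_mapping_sum_single:
  "(\<Sum>m\<in>Poly_Mapping.keys p. Poly_Mapping.single m (Poly_Mapping.lookup p m)) = (p :: 'k \<Rightarrow>\<^sub>0 'a::comm_monoid_add)"
proof (rule poly_mapping_eqI)
  fix k
  have "(\<Sum>m\<in>Poly_Mapping.keys p. Poly_Mapping.lookup (Poly_Mapping.single m (Poly_Mapping.lookup p m)) k)
    = (\<Sum>m\<in>Poly_Mapping.keys p. if m = k then Poly_Mapping.lookup p k else 0)"
    by (intro sum.cong) (auto simp: lookup_single when_def)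
  then show "Poly_Mapping.lookup (\<Sum>m\<in>Poly_Mapping.keys p. Poly_Mapping.single m (Poly_Mapping.lookup p m)) k = Poly_Mapping.lookup p k"
    by (auto simp: lookup_sum in_keys_iff)
qed

lemma poly_mapping_single_induct [case_names add single]:
  fixes p :: "'k \<Rightarrow>\<^sub>0 'a::comm_monoid_add"
  assumes "\<And>p q. P p \<Longrightarrow> P q \<Longrightarrow> P (p + q)" "\<And>m c. P (Poly_Mapping.single m c)"
  shows "P p"
proof -
  have P0: "P 0" using assms(2)[of undefined 0] by simp
  have "P (\<Sum>m\<in>S. Poly_Mapping.single m (Poly_Mapping.lookup p m))" if "finite S" for S
    using that by (induction S) (auto intro: P0 assms)
  from this[of "Poly_Mapping.keys p"] show ?thesis by (simp add: poly_mapping_sum_single)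
qed

lemma comm_ring_homI:
  assumes "f 1 = 1" "\<And>a b. f (a + b) = f a + f b" "\<And>a b. f (a * b) = f a * f b"
  shows "comm_ring_hom (f :: 'a::comm_ring_1 \<Rightarrow> 'b::comm_ring_1)"
proof -
  have "f 0 + f 0 = f 0" using assms(2)[of 0 0] by simp
  then show ?thesis using assms by unfold_locales auto
qed

text \<open>Multiplicativity is additive in each factor, so two inductions reduce it to products of
  single terms, where it says that exponents add.\<close>

lemma comm_ring_hom_ev:
  assumes "comm_ring_hom h"
  shows "comm_ring_hom (ev h s)"
proof -
  interpret h: comm_ring_hom h by fact
  let ?M = "\<lambda>m. \<Prod>i\<in>Poly_Mapping.keys m. s i ^ Poly_Mapping.lookup m i"
  have M: "?M m = (\<Prod>i\<in>S. s i ^ Poly_Mapping.lookup m i)" if "finite S" "Poly_Mapping.keys m \<subseteq> S" for m S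
    using that by (intro prod.mono_neutral_left) (auto simp: in_keys_iff)
  have Madd: "?M (m + m') = ?M m * ?M m'" for m m'
    using M[of "Poly_Mapping.keys m \<union> Poly_Mapping.keys m'" m] M[of "Poly_Mapping.keys m \<union> Poly_Mapping.keys m'" m']
      M[of "Poly_Mapping.keys m \<union> Poly_Mapping.keys m'" "m + m'"] keys_add[of m m']
    by (simp add: lookup_add power_add prod.distrib)
  have add: "ev h s (p + q) = ev h s p + ev h s q" for p q
    unfolding ev_def
    by (rule sum_keys_add[where h="\<lambda>m c. h c * ?M m"]) (auto simp: h.hom_add algebra_simps)
  have single: "ev h s (Poly_Mapping.single m c) = h c * ?M m" for m c
    by (cases "c = 0") (auto simp: ev_def)
  have ss: "ev h s (Poly_Mapping.single m c * Poly_Mapping.single m' c') =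
      ev h s (Poly_Mapping.single m c) * ev h s (Poly_Mapping.single m' c')" for m m' c c'
    by (simp add: mult_single single Madd h.hom_mult)
  have sp: "ev h s (Poly_Mapping.single m c * q) = ev h s (Poly_Mapping.single m c) * ev h s q" for m c q
    by (induction q rule: poly_mapping_single_induct) (auto simp: ss add distrib_left)
  have "ev h s (p * q) = ev h s p * ev h s q" for p q
    by (induction p rule: poly_mapping_single_induct) (auto simp: sp add distrib_right)
  moreover have "ev h s 1 = 1"
    using single[of 0 1] by simp
  ultimately show ?thesis using add by (intro comm_ring_homI) auto
qed

lemma Const_hom: "comm_ring_hom (Const :: 'a::comm_ring_1 \<Rightarrow> 'a mpoly)"
  by (rule comm_ring_homI) (auto simp: Const_def single_add mult_single)

interpretation Const: comm_ring_hom "Const :: 'a::comm_ring_1 \<Rightarrow> 'a mpoly"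
  by (rule Const_hom)

interpretation subst: comm_ring_hom "subst_mp s" for s :: "nat \<Rightarrow> 'a::comm_ring_1 mpoly"
  unfolding subst_mp_eq_ev by (rule comm_ring_hom_ev[OF Const_hom])

lemma ev_Const: "comm_ring_hom h \<Longrightarrow> ev h s (Const c) = h c"
proof -
  assume "comm_ring_hom h"
  then interpret h: comm_ring_hom h .
  show ?thesis by (cases "c = 0") (auto simp: ev_def Const_def)
qed

lemma ev_Var: "comm_ring_hom h \<Longrightarrow> ev h s (Var i) = s i"
proof -
  assume "comm_ring_hom h"
  then interpret h: comm_ring_hom h .
  show ?thesis by (auto simp: ev_def Var_def)
qed

lemma subst_Const [simp]: "subst_mp s (Const c) = Const c"
  by (simp add: subst_mp_eq_ev ev_Const[OF Const_hom])

lemma subst_Var [simp]: "subst_mp s (Var i) = s i"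
  by (simp add: subst_mp_eq_ev ev_Var[OF Const_hom])

lemma Var_power: "Var i ^ k = Poly_Mapping.single (Poly_Mapping.single i k) (1::'a::comm_ring_1)"
  by (induction k) (auto simp: Var_def mult_single simp flip: single_add)

lemma monomial_eq:
  "Poly_Mapping.single m (c::'a::comm_ring_1) = Const c * (\<Prod>i\<in>Poly_Mapping.keys m. Var i ^ Poly_Mapping.lookup m i)"
proof -
  have "(\<Prod>i\<in>S. Poly_Mapping.single (g i) (1::'a)) = Poly_Mapping.single (\<Sum>i\<in>S. g i) 1" if "finite S" for S and g :: "nat \<Rightarrow> nat \<Rightarrow>\<^sub>0 nat"
    using that by (induction S) (auto simp: mult_single)
  then show ?thesis
    by (simp add: Const_def Var_power poly_mapping_sum_single mult_single)
qed

text \<open>Every polynomial arises from constants by sums and by multiplication with one variable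
  at a time. Restricting those variables to \<open>V\<close> lets a proof use what is known about
  the variables that occur, for instance with \<open>V = vars p\<close>.\<close>

lemma mpoly_vars_induct [consumes 1, case_names Const add mult]:
  fixes p :: "'a::comm_ring_1 mpoly"
  assumes "vars p \<subseteq> V" "\<And>c. P (Const c)" "\<And>p q. P p \<Longrightarrow> P q \<Longrightarrow> P (p + q)"
    "\<And>p i. i \<in> V \<Longrightarrow> P p \<Longrightarrow> P (p * Var i)"
  shows "P p"
proof -
  have pow: "P (q * Var i ^ k)" if "P q" "i \<in> V" for q i k
    using that by (induction k) (auto intro!: assms(4) simp flip: mult.assoc simp: power_Suc2 simp del: power_Suc)
  have "P (Const c * (\<Prod>i\<in>S. Var i ^ e i))" if "finite S" "S \<subseteq> V" for c S e
    using that
  proof (induction S)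
    case empty
    then show ?case using assms(2) by simp
  next
    case (insert x F)
    then show ?case using pow[of "Const c * (\<Prod>i\<in>F. Var i ^ e i)" x "e x"] by (simp add: ac_simps)
  qed
  then have s: "P (Poly_Mapping.single m c)" if "Poly_Mapping.keys m \<subseteq> V" for m c
    using that by (simp add: monomial_eq)
  have "P (\<Sum>m\<in>S. Poly_Mapping.single m (Poly_Mapping.lookup p m))" if "finite S" "S \<subseteq> Poly_Mapping.keys p" for S
    using that
  proof (induction S)
    case empty
    then show ?case using assms(2)[of 0] by simp
  next
    case (insert x F)
    have "Poly_Mapping.keys x \<subseteq> V" using insert assms(1) by (auto simp: vars_def)
    then show ?case using insert by (auto intro!: assms(3) s)
  qed
  from this[of "Poly_Mapping.keys p"] show ?thesis by (simp add: poly_mapping_sum_single)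
qed

lemmas mpoly_induct [case_names Const add mult] = mpoly_vars_induct[where V=UNIV, OF subset_UNIV]

section \<open>Variables, substitution and derivatives\<close>

lemma vars_Const [simp]: "vars (Const c) = {}"
  by (auto simp: vars_def Const_def)

lemma vars_0 [simp]: "vars 0 = {}" and vars_1 [simp]: "vars 1 = {}"
  by (auto simp: vars_def)

lemma vars_Var [simp]: "vars (Var i :: 'a::comm_ring_1 mpoly) = {i}"
  by (auto simp: vars_def Var_def)

lemma vars_add: "vars (p + q) \<subseteq> vars p \<union> vars q"
  using keys_add[of p q] by (auto simp: vars_def)

lemma vars_uminus [simp]: "vars (- p) = vars p"
  by (auto simp: vars_def in_keys_iff)

lemma vars_diff: "vars (p - q) \<subseteq> vars p \<union> vars q"
  using vars_add[of p "- q"] by simp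

lemma vars_mult: "vars (p * q) \<subseteq> vars p \<union> vars q"
proof
  fix i assume "i \<in> vars (p * q)"
  then obtain m where m: "m \<in> Poly_Mapping.keys (p * q)" "i \<in> Poly_Mapping.keys m" by (auto simp: vars_def)
  then obtain a b where "m = a + b" "a \<in> Poly_Mapping.keys p" "b \<in> Poly_Mapping.keys q"
    using keys_mult[of p q] by auto
  then show "i \<in> vars p \<union> vars q" using m(2) keys_add[of a b] by (auto simp: vars_def)
qed

lemma vars_power: "vars (p ^ k) \<subseteq> vars p"
proof (induction k)
  case (Suc k)
  then show ?case using vars_mult[of p "p ^ k"] by auto
qed auto

lemma vars_sum: "vars (\<Sum>i\<in>S. f i) \<subseteq> (\<Union>i\<in>S. vars (f i))"
proof (induction S rule: infinite_finite_induct)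
  case (insert x S)
  then show ?case using vars_add[of "f x" "sum f S"] by auto
qed auto

lemma vars_subst:
  assumes "\<And>i. i \<in> vars p \<Longrightarrow> vars (s i) \<subseteq> V"
  shows "vars (subst_mp s p) \<subseteq> V"
proof -
  have "vars p \<subseteq> vars p" ..
  then show ?thesis
  proof (induction p rule: mpoly_vars_induct)
    case (add p q)
    then show ?case using vars_add[of "subst_mp s p" "subst_mp s q"] by (auto simp: subst.hom_add)
  next
    case (mult p i)
    then show ?case using vars_mult[of "subst_mp s p" "s i"] assms[of i] by (auto simp: subst.hom_mult)
  qed auto
qed

lemma subst_cong:
  assumes "\<And>i. i \<in> vars p \<Longrightarrow> s i = t i"
  shows "subst_mp s p = subst_mp t p"
proof -
  have "vars p \<subseteq> vars p" ..
  then show ?thesis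
    by (induction p rule: mpoly_vars_induct) (auto simp: subst.hom_add subst.hom_mult assms)
qed

lemma subst_subst: "subst_mp s (subst_mp t p) = subst_mp (\<lambda>i. subst_mp s (t i)) p"
  by (induction p rule: mpoly_induct) (auto simp: subst.hom_add subst.hom_mult)

lemma subst_Var_id [simp]: "subst_mp Var p = p"
  by (induction p rule: mpoly_induct) (auto simp: subst.hom_add subst.hom_mult)

section \<open>Formal partial derivatives: Leibniz rule and chain rule\<close>

lemma pderiv_mp_single:
  "pderiv_mp j (Poly_Mapping.single m c) =
    Poly_Mapping.single (m - Poly_Mapping.single j 1) (of_nat (Poly_Mapping.lookup m j) * c)"
  by (cases "c = 0") (auto simp: pderiv_mp_def)

lemma pderiv_mp_add [simp]: "pderiv_mp j (p + q) = pderiv_mp j p + pderiv_mp j q"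
  unfolding pderiv_mp_def
  by (rule sum_keys_add[where h="\<lambda>m c. Poly_Mapping.single (m - Poly_Mapping.single j 1) (of_nat (Poly_Mapping.lookup m j) * c)"])
    (auto simp: distrib_left single_add)

lemma pderiv_mp_Const [simp]: "pderiv_mp j (Const c) = 0"
  by (simp add: Const_def pderiv_mp_single)

lemma pderiv_mp_Var: "pderiv_mp j (Var i) = (if i = j then 1 else 0)"
  by (auto simp: Var_def pderiv_mp_single lookup_single)

lemma pderiv_mp_mult: "pderiv_mp j (p * q) = pderiv_mp j p * q + p * pderiv_mp j q"
proof -
  \<comment> \<open>Subtraction of exponents is truncated, so it commutes with adding
    \<open>m'\<close> only if \<open>X_j\<close> occurs in \<open>m\<close>. Otherwise the
    coefficient \<open>of_nat (lookup m j)\<close> vanishes, which the case distinctions below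
    exploit.\<close>
  have eq: "(m + m') - Poly_Mapping.single j 1 = (m - Poly_Mapping.single j 1) + m'"
    if "Poly_Mapping.lookup m j \<noteq> 0" for m m' :: "nat \<Rightarrow>\<^sub>0 nat"
    using that by (intro poly_mapping_eqI) (auto simp: lookup_add lookup_minus lookup_single when_def)
  have ss: "pderiv_mp j (Poly_Mapping.single m c * Poly_Mapping.single m' c') =
      pderiv_mp j (Poly_Mapping.single m c) * Poly_Mapping.single m' c' +
      Poly_Mapping.single m c * pderiv_mp j (Poly_Mapping.single m' c')" for m m' and c c' :: 'a
  proof -
    have 1: "Poly_Mapping.single (m + m' - Poly_Mapping.single j 1) (of_nat (Poly_Mapping.lookup m j) * (c * c'))
      = Poly_Mapping.single (m - Poly_Mapping.single j 1 + m') (of_nat (Poly_Mapping.lookup m j) * c * c')"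
      using eq[of m m'] by (cases "Poly_Mapping.lookup m j = 0") (auto simp: mult.assoc)
    have 2: "Poly_Mapping.single (m + m' - Poly_Mapping.single j 1) (of_nat (Poly_Mapping.lookup m' j) * (c * c'))
      = Poly_Mapping.single (m + (m' - Poly_Mapping.single j 1)) (c * (of_nat (Poly_Mapping.lookup m' j) * c'))"
      using eq[of m' m] by (cases "Poly_Mapping.lookup m' j = 0") (auto simp: mult.left_commute add.commute)
    show ?thesis
      using 1 2 by (simp add: mult_single pderiv_mp_single lookup_add distrib_right single_add)
  qed
  have sp: "pderiv_mp j (Poly_Mapping.single m c * q) =
      pderiv_mp j (Poly_Mapping.single m c) * q + Poly_Mapping.single m c * pderiv_mp j q" for m c
    by (induction q rule: poly_mapping_single_induct) (auto simp: ss algebra_simps)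
  show ?thesis
    by (induction p rule: poly_mapping_single_induct) (simp_all add: sp distrib_right)
qed

lemma pderiv_mp_0 [simp]: "pderiv_mp j 0 = 0" and pderiv_mp_1 [simp]: "pderiv_mp j 1 = 0"
  using pderiv_mp_Const[of j 0] pderiv_mp_Const[of j 1] by simp_all

lemma pderiv_mp_of_nat [simp]: "pderiv_mp j (of_nat k) = 0"
  by (induction k) auto

lemma pderiv_mp_uminus [simp]: "pderiv_mp j (- p) = - pderiv_mp j p"
  using pderiv_mp_add[of j p "- p"] by (simp add: eq_neg_iff_add_eq_0 add.commute del: pderiv_mp_add)

lemma pderiv_mp_diff [simp]: "pderiv_mp j (p - q) = pderiv_mp j p - pderiv_mp j q"
  using pderiv_mp_add[of j p "- q"] by (simp del: pderiv_mp_add)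

lemma pderiv_mp_sum [simp]: "pderiv_mp j (\<Sum>i\<in>S. f i) = (\<Sum>i\<in>S. pderiv_mp j (f i))"
  by (induction S rule: infinite_finite_induct) auto

lemma pderiv_mp_cmult [simp]: "pderiv_mp j (Const c * p) = Const c * pderiv_mp j p"
  by (simp add: pderiv_mp_mult)

lemma pderiv_mp_power: "pderiv_mp j (p ^ k) = of_nat k * p ^ (k - 1) * pderiv_mp j p"
proof (induction k)
  case (Suc k)
  then show ?case by (cases k) (auto simp: pderiv_mp_mult algebra_simps)
qed auto

lemma pderiv_mp_not_vars: "j \<notin> vars p \<Longrightarrow> pderiv_mp j p = 0"
proof -
  assume j: "j \<notin> vars p"
  have "vars p \<subseteq> vars p" ..
  then show ?thesis
    by (induction p rule: mpoly_vars_induct) (use j in \<open>auto simp: pderiv_mp_mult pderiv_mp_Var\<close>)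
qed

lemma pderiv_mp_commute: "pderiv_mp i (pderiv_mp j p) = pderiv_mp j (pderiv_mp i p)"
  by (induction p rule: mpoly_induct) (auto simp: pderiv_mp_mult pderiv_mp_Var)

text \<open>The chain rule, by induction on the construction of \<open>p\<close>. When
  \<open>p\<close> is multiplied by \<open>Var k\<close>, the new term is the one with
  \<open>i = k\<close>, and \<open>k \<in> V\<close> makes it occur in the sum.\<close>

lemma pderiv_mp_subst:
  assumes "vars p \<subseteq> V" "finite V"
  shows "pderiv_mp j (subst_mp s p) = (\<Sum>i\<in>V. subst_mp s (pderiv_mp i p) * pderiv_mp j (s i))"
  using assms(1)
proof (induction p rule: mpoly_vars_induct)
  case (mult p k)
  have "(\<Sum>i\<in>V. subst_mp s (pderiv_mp i (p * Var k)) * pderiv_mp j (s i)) =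
    (\<Sum>i\<in>V. subst_mp s (pderiv_mp i p) * pderiv_mp j (s i) * s k) +
    (\<Sum>i\<in>V. if i = k then subst_mp s p * pderiv_mp j (s k) else 0)"
    unfolding sum.distrib[symmetric]
    by (intro sum.cong) (auto simp: pderiv_mp_mult pderiv_mp_Var subst.hom_add subst.hom_mult algebra_simps)
  then show ?case using mult assms(2)
    by (simp add: subst.hom_mult pderiv_mp_mult sum_distrib_right)
qed (auto simp: subst.hom_add sum.distrib algebra_simps)

section \<open>Irreducibility of linear combinations\<close>

text \<open>\<open>uni j p\<close> is \<open>p\<close> as a univariate polynomial in \<open>X\<^sub>j\<close>. Its coefficients
  are taken in the full polynomial ring, although they do not involve \<open>X\<^sub>j\<close>.\<close>

definition uni :: "nat \<Rightarrow> 'a::comm_ring_1 mpoly \<Rightarrow> 'a mpoly poly" where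
  "uni j = ev (\<lambda>c. [:Const c:]) (\<lambda>i. if i = j then [:0, 1:] else [:Var i:])"

lemma uni_base_hom: "comm_ring_hom (\<lambda>c::'a::comm_ring_1. [:Const c:])"
  by (rule comm_ring_homI) (auto simp: Const.hom_add Const.hom_mult)

interpretation uni: comm_ring_hom "uni j :: 'a::comm_ring_1 mpoly \<Rightarrow> _"
  unfolding uni_def by (rule comm_ring_hom_ev[OF uni_base_hom])

lemma uni_Const [simp]: "uni j (Const c) = [:Const c:]"
  by (simp add: uni_def ev_Const[OF uni_base_hom])

lemma uni_Var: "uni j (Var i) = (if i = j then [:0, 1:] else [:Var i:])"
  by (simp add: uni_def ev_Var[OF uni_base_hom])

lemma uni_not_vars: "j \<notin> vars p \<Longrightarrow> uni j p = [:p:]"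
proof -
  assume j: "j \<notin> vars p"
  have "vars p \<subseteq> vars p" ..
  then show ?thesis
    by (induction p rule: mpoly_vars_induct) (use j in \<open>auto simp: uni.hom_add uni.hom_mult uni_Var\<close>)
qed

text \<open>Being a left inverse of \<open>uni j\<close>, evaluation at \<open>Var j\<close> shows
  that \<open>uni j\<close> is injective, so a nonzero polynomial has a nonzero leading coefficient
  in \<open>X_j\<close>.\<close>

lemma poly_uni: "poly (uni j p) (Var j) = p"
  by (induction p rule: mpoly_induct) (auto simp: uni.hom_add uni.hom_mult uni_Var)

lemma uni_eq_0_iff [simp]: "uni j p = 0 \<longleftrightarrow> p = 0"
  using poly_uni[of j p] by auto

lemma uni_pderiv_same: "uni j (pderiv_mp j p) = pderiv (uni j p)"
  by (induction p rule: mpoly_induct)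
    (auto simp: uni.hom_add uni.hom_mult uni_Var pderiv_mp_mult pderiv_mp_Var
      Polynomial.pderiv_add Polynomial.pderiv_mult pderiv_pCons ac_simps)

text \<open>With respect to \<open>X_i\<close> the variable \<open>X_j\<close> is a constant, so the
  derivative acts on each coefficient separately. The index \<open>k\<close> is generalized because
  multiplication by \<open>X_j\<close> shifts the coefficients.\<close>

lemma coeff_uni_pderiv:
  assumes "i \<noteq> j"
  shows "coeff (uni j (pderiv_mp i p)) k = pderiv_mp i (coeff (uni j p) k)"
proof (induction p arbitrary: k rule: mpoly_induct)
  case (mult p l)
  then show ?case using assms
    by (cases k) (auto simp: uni.hom_add uni.hom_mult uni_Var pderiv_mp_mult pderiv_mp_Var algebra_simps)
qed (auto simp: uni.hom_add coeff_pCons split: nat.splits)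

lemma degree_uni_pderiv:
  fixes p :: "'a::field_char_0 mpoly"
  shows "degree (uni j (pderiv_mp j p)) = degree (uni j p) - 1"
  by (simp add: uni_pderiv_same degree_pderiv)

lemma degree_uni_mult:
  fixes p :: "'a::field_char_0 mpoly"
  shows "p \<noteq> 0 \<Longrightarrow> q \<noteq> 0 \<Longrightarrow> degree (uni j (p * q)) = degree (uni j p) + degree (uni j q)"
  by (simp add: uni.hom_mult degree_mult_eq)

text \<open>In characteristic zero a polynomial of positive degree in \<open>X_j\<close> has a
  nonzero derivative, so vanishing derivatives become a statement about degrees, which add up in
  products.\<close>

lemma pderiv_eq_0_iff_degree:
  fixes p :: "'a::field_char_0 mpoly"
  shows "pderiv_mp j p = 0 \<longleftrightarrow> degree (uni j p) = 0"
  by (metis uni_eq_0_iff uni_pderiv_same pderiv_eq_0_iff)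

section \<open>Constants and units of the polynomial ring\<close>

lemma Const_eq_iff [simp]: "Const a = Const b \<longleftrightarrow> a = b"
  by (metis Const_def lookup_single_eq)

lemma Const_eq_0_iff [simp]: "Const a = 0 \<longleftrightarrow> a = 0"
  using Const_eq_iff[of a 0] by (simp del: Const_eq_iff)

text \<open>Degrees in \<open>X_i\<close> add up in a product, so both factors of a nonzero constant
  have degree 0 in every variable.\<close>

lemma pderiv_unit:
  fixes a b :: "'a::field_char_0 mpoly"
  assumes "a * b = Const c" "c \<noteq> 0"
  shows "pderiv_mp i a = 0"
proof -
  have "a \<noteq> 0" "b \<noteq> 0" using assms by auto
  then have "degree (uni i a) + degree (uni i b) = 0"
    using degree_uni_mult[of a b i] assms(1) by simp
  then show ?thesis by (simp add: pderiv_eq_0_iff_degree)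
qed

lemma lookup_pderiv_mp:
  "Poly_Mapping.lookup (pderiv_mp j p) m =
    of_nat (Suc (Poly_Mapping.lookup m j)) * Poly_Mapping.lookup p (m + Poly_Mapping.single j 1)"
proof (induction p rule: poly_mapping_single_induct)
  case (add p q)
  then show ?case by (simp add: lookup_add algebra_simps)
next
  case (single m' c)
  consider "m' = m + Poly_Mapping.single j 1" | "m' \<noteq> m + Poly_Mapping.single j 1" "Poly_Mapping.lookup m' j = 0"
    | "m' \<noteq> m + Poly_Mapping.single j 1" "Poly_Mapping.lookup m' j \<noteq> 0" by blast
  then show ?case
  proof cases
    \<comment> \<open>As \<open>X_j\<close> occurs in \<open>m'\<close>, lowering its exponent is
      undone by raising it again, so the derivative of this term sits at a monomial other than
      \<open>m\<close>.\<close>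
    case 3
    have "(m' - Poly_Mapping.single j 1) + Poly_Mapping.single j 1 = m'"
      using 3(2) by (intro poly_mapping_eqI) (auto simp: lookup_add lookup_minus lookup_single when_def)
    then have "m' - Poly_Mapping.single j 1 \<noteq> m" using 3(1) by auto
    then show ?thesis using 3 by (simp add: pderiv_mp_single lookup_single)
  qed (auto simp: pderiv_mp_single lookup_single lookup_add)
qed

text \<open>A monomial \<open>m \<noteq> 0\<close> contains some \<open>X_j\<close>. Its coefficient
  times the exponent of \<open>X_j\<close>, which is nonzero in characteristic zero, is a
  coefficient of the derivative by \<open>X_j\<close>.\<close>

lemma pderiv_all_0_imp_Const:
  fixes p :: "'a::field_char_0 mpoly"
  assumes "\<And>i. pderiv_mp i p = 0"
  shows "p = Const (Poly_Mapping.lookup p 0)"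
proof (rule poly_mapping_eqI)
  fix m
  show "Poly_Mapping.lookup p m = Poly_Mapping.lookup (Const (Poly_Mapping.lookup p 0)) m"
  proof (cases "m = 0")
    case False
    then obtain j where j: "Poly_Mapping.lookup m j \<noteq> 0" by (auto simp: poly_mapping_eq_iff fun_eq_iff)
    have "(m - Poly_Mapping.single j 1) + Poly_Mapping.single j 1 = m"
      using j by (intro poly_mapping_eqI) (auto simp: lookup_add lookup_minus lookup_single when_def)
    then have "of_nat (Suc (Poly_Mapping.lookup (m - Poly_Mapping.single j 1) j)) * Poly_Mapping.lookup p m = 0"
      using lookup_pderiv_mp[of j p "m - Poly_Mapping.single j 1"] assms[of j] by simp
    then have "Poly_Mapping.lookup p m = 0" by (metis mult_eq_0_iff of_nat_eq_0_iff nat.distinct(1))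
    then show ?thesis using False by (simp add: Const_def lookup_single)
  qed (simp add: Const_def)
qed

lemma unit_imp_Const:
  fixes a b :: "'a::field_char_0 mpoly"
  assumes "a * b = Const c" "c \<noteq> 0"
  obtains a' where "a = Const a'" "a' \<noteq> 0"
  using pderiv_all_0_imp_Const[OF pderiv_unit[OF assms]] assms
  by (metis Const_eq_0_iff mult_zero_left)

lemma Const_dvd_1: "c \<noteq> 0 \<Longrightarrow> Const (c::'a::field) dvd 1"
  by (rule dvdI[of _ _ "Const (inverse c)"]) (simp flip: Const.hom_mult)

section \<open>Two criteria for irreducibility\<close>

text \<open>\<open>p\<close> has degree 1 in \<open>X_k\<close> with constant leading coefficient.
  One of two factors is then free of \<open>X_k\<close>, and as such it divides the leading
  coefficient, which is a unit.\<close>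

lemma irreducible_of_pderiv_Const:
  fixes p :: "'a::field_char_0 mpoly"
  assumes "pderiv_mp k p = Const c" "c \<noteq> 0"
  shows "irreducible p"
proof -
  have u: "pderiv (uni k p) = [:Const c:]"
    using assms(1) by (simp flip: uni_pderiv_same)
  then have d: "degree (uni k p) = 1"
    using degree_uni_pderiv[of k p] pderiv_eq_0_iff_degree[of k p] assms by simp
  have c1: "coeff (uni k p) 1 = Const c"
    using coeff_pderiv[of "uni k p" 0] u by simp
  have p0: "p \<noteq> 0" using d by (metis degree_0 uni.hom_zero zero_neq_one)
  have "\<not> p dvd 1"
  proof
    assume "p dvd 1"
    then obtain q where q: "p * q = Const 1" by (auto simp: dvd_def)
    with pderiv_unit[OF q] assms show False by simp
  qed
  moreover have factor: "g dvd 1" if "p = g * h" "degree (uni k g) = 0" for g h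
  proof -
    from that(2) obtain g0 where g0: "uni k g = [:g0:]" by (metis degree_eq_zeroE)
    have "poly (uni k g) (Var k) = g0" using g0 by simp
    then have "g = g0" by (simp add: poly_uni)
    have "coeff (uni k (g * h)) 1 = g * coeff (uni k h) 1" using g0 \<open>g = g0\<close> by (simp add: uni.hom_mult)
    then have "g * coeff (uni k h) 1 = Const c" using c1 that(1) by simp
    then have "g dvd Const c" by (metis dvdI)
    then show "g dvd 1" using Const_dvd_1[OF assms(2)] dvd_trans by blast
  qed
  moreover have "g dvd 1 \<or> h dvd 1" if gh: "p = g * h" for g h
  proof -
    have "g \<noteq> 0" "h \<noteq> 0" using gh p0 by auto
    then have "degree (uni k g) + degree (uni k h) = 1" using d gh by (simp add: degree_uni_mult)
    then have "degree (uni k g) = 0 \<or> degree (uni k h) = 0" by linarith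
    then show ?thesis using factor[of g h] factor[of h g] gh by (auto simp: mult.commute)
  qed
  ultimately show ?thesis using p0 by (auto simp: irreducible_def)
qed

text \<open>In the application \<open>V\<close> indexes the variables x, \<open>f\<close> is a
  combination of the components of a Keller map, and \<open>X_t\<close> is one of the variables y.
  The gradient of a factor in x is parallel to that of \<open>f\<close>; since the latter is
  unimodular by \<open>u\<close>, parallel means a polynomial multiple.\<close>

lemma gradient_of_factor:
  fixes f r g h :: "'a::field_char_0 mpoly"
  assumes gh: "f + r = g * h"
    and V: "vars f \<subseteq> V" "vars r \<inter> V = {}"
    and u: "(\<Sum>i\<in>V. u i * pderiv_mp i f) = 1"
    and t: "t \<notin> V" "degree (uni t r) \<noteq> 0" "lead_coeff (uni t r) = Const a" "a \<noteq> 0"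
  obtains w where "\<And>j. j \<in> V \<Longrightarrow> pderiv_mp j g = w * pderiv_mp j f"
proof -
  have pd: "pderiv_mp i f = pderiv_mp i g * h + g * pderiv_mp i h" if "i \<in> V" for i
  proof -
    have "pderiv_mp i r = 0" using that V(2) by (intro pderiv_mp_not_vars) auto
    then have "pderiv_mp i f = pderiv_mp i (g * h)" by (simp flip: gh)
    then show ?thesis by (simp add: pderiv_mp_mult)
  qed
  have tf: "t \<notin> vars f" using t(1) V(1) by auto
  have "uni t (g * h) = [:f:] + uni t r"
    using tf by (simp add: uni.hom_add uni_not_vars flip: gh)
  \<comment> \<open>\<open>f\<close> is free of \<open>X_t\<close> and only changes the constant
    coefficient, whereas \<open>r\<close> has positive degree in \<open>X_t\<close>.\<close>
  then have "lead_coeff (uni t (g * h)) = Const a"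
    using t(2,3) by (simp add: degree_add_eq_right coeff_eq_0)
  then have lc: "lead_coeff (uni t g) * lead_coeff (uni t h) = Const a"
    by (simp add: uni.hom_mult lead_coeff_mult)
  have \<delta>: "pderiv_mp i f * pderiv_mp j g = pderiv_mp j f * pderiv_mp i g" if "i \<in> V" "j \<in> V" for i j
  proof -
    define \<delta> where "\<delta> = pderiv_mp i f * pderiv_mp j g - pderiv_mp j f * pderiv_mp i g"
    have it: "i \<noteq> t" "j \<noteq> t" using that t(1) by auto
    have uf: "uni t (pderiv_mp l f) = [:pderiv_mp l f:]" if "l \<noteq> t" for l
      using that tf coeff_uni_pderiv[OF that, of f] by (intro poly_eqI) (auto simp: uni_not_vars coeff_pCons split: nat.splits)
    have c: "coeff (uni t \<delta>) k = pderiv_mp i f * pderiv_mp j (coeff (uni t g) k)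
         - pderiv_mp j f * pderiv_mp i (coeff (uni t g) k)" for k
      by (simp add: \<delta>_def uni.hom_minus uni.hom_mult uf it coeff_uni_pderiv)
    \<comment> \<open>Above the degree of \<open>g\<close> the coefficients of \<open>g\<close>
      vanish; at the degree itself the coefficient divides a nonzero constant by \<open>lc\<close>,
      so its derivatives vanish.\<close>
    have c0: "coeff (uni t \<delta>) k = 0" if "k \<ge> degree (uni t g)" for k
    proof (cases "k = degree (uni t g)")
      case True
      then show ?thesis unfolding c using pderiv_unit[OF lc t(4)] by simp
    next
      case False
      then show ?thesis unfolding c using that by (simp add: coeff_eq_0)
    qed
    \<comment> \<open>The terms with \<open>h\<close> undifferentiated cancel. A multiple of
      \<open>g\<close> without terms of degree \<open>degree (uni t g)\<close> or more can only be
      zero.\<close>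
    have "\<delta> = g * (pderiv_mp i h * pderiv_mp j g - pderiv_mp j h * pderiv_mp i g)"
      unfolding \<delta>_def pd[OF that(1)] pd[OF that(2)] by (simp add: algebra_simps)
    then obtain q where q: "\<delta> = g * q" by blast
    have "\<delta> = 0"
    proof (rule ccontr)
      assume "\<delta> \<noteq> 0"
      then have "degree (uni t \<delta>) \<ge> degree (uni t g)" using q by (auto simp: degree_uni_mult)
      with c0 have "lead_coeff (uni t \<delta>) = 0" by blast
      with \<open>\<delta> \<noteq> 0\<close> show False by simp
    qed
    then show ?thesis by (simp add: \<delta>_def)
  qed
  show ?thesis
  proof (rule that)
    fix j assume j: "j \<in> V"
    \<comment> \<open>Inserting the factor 1 in the form \<open>u\<close> and swapping indices by
      \<open>\<delta>\<close> produces the multiplier.\<close>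
    have "pderiv_mp j g = (\<Sum>i\<in>V. u i * pderiv_mp i f) * pderiv_mp j g" by (simp add: u)
    also have "\<dots> = (\<Sum>i\<in>V. u i * (pderiv_mp i f * pderiv_mp j g))" by (simp add: sum_distrib_right mult.assoc)
    also have "\<dots> = (\<Sum>i\<in>V. u i * (pderiv_mp j f * pderiv_mp i g))" using \<delta> j by (intro sum.cong) auto
    also have "\<dots> = (\<Sum>i\<in>V. u i * pderiv_mp i g) * pderiv_mp j f" by (simp add: sum_distrib_left ac_simps)
    finally show "pderiv_mp j g = (\<Sum>i\<in>V. u i * pderiv_mp i g) * pderiv_mp j f" .
  qed
qed

lemma irreducible_separated:
  fixes f r :: "'a::field_char_0 mpoly"
  assumes V: "vars f \<subseteq> V" "vars r \<inter> V = {}"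
    and u: "(\<Sum>i\<in>V. u i * pderiv_mp i f) = 1"
    and t: "t \<notin> V" "degree (uni t r) \<noteq> 0" "lead_coeff (uni t r) = Const a" "a \<noteq> 0"
  shows "irreducible (f + r)"
proof -
  have pdp: "pderiv_mp i (f + r) = pderiv_mp i f" if "i \<in> V" for i
    using pderiv_mp_not_vars[of i r] that V(2) by auto
  obtain j where j: "j \<in> V" "pderiv_mp j f \<noteq> 0"
  proof (rule ccontr)
    assume "\<not> thesis"
    with that have "(\<Sum>i\<in>V. u i * pderiv_mp i f) = 0" by (intro sum.neutral) auto
    with u show False by simp
  qed
  have degf: "degree (uni j f) \<noteq> 0" using j(2) by (simp add: pderiv_eq_0_iff_degree)
  have p0: "f + r \<noteq> 0" using pdp[OF j(1)] j(2) by (metis pderiv_mp_0)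
  have degp: "degree (uni j (f + r)) = degree (uni j f)"
  proof -
    have "j \<notin> vars r" using j(1) V(2) by auto
    then show ?thesis using degf by (simp add: uni.hom_add uni_not_vars degree_add_eq_left)
  qed
  \<comment> \<open>Differentiation lowers a positive degree in \<open>X_j\<close> by exactly one,
    so a nonzero multiple of \<open>pderiv_mp j f\<close> can only be the derivative of something of
    degree at least that of \<open>f\<close>.\<close>
  have big: "degree (uni j g) \<ge> degree (uni j f)" if "pderiv_mp j g = w * pderiv_mp j f" "w \<noteq> 0" for g w
  proof -
    have "pderiv_mp j g \<noteq> 0" using that j by simp
    then have "degree (uni j g) \<noteq> 0" by (simp add: pderiv_eq_0_iff_degree)
    moreover have "degree (uni j g) - 1 = degree (uni j w) + (degree (uni j f) - 1)"
      using degree_uni_mult[OF that(2) j(2), of j] that(1) degree_uni_pderiv[of j] by metis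
    ultimately show ?thesis using degf by linarith
  qed
  \<comment> \<open>If the derivatives of \<open>g\<close> in \<open>V\<close> vanish, then
    \<open>g\<close> divides every \<open>pderiv_mp i f\<close> and hence their combination
    1.\<close>
  have unit: "g dvd 1" if "f + r = g * h" "\<And>i. i \<in> V \<Longrightarrow> pderiv_mp i g = 0" for g h
  proof -
    have "pderiv_mp i f = g * pderiv_mp i h" if "i \<in> V" for i
      using pdp[OF that] \<open>\<And>i. i \<in> V \<Longrightarrow> pderiv_mp i g = 0\<close>[OF that] \<open>f + r = g * h\<close> by (simp add: pderiv_mp_mult)
    then have "1 = (\<Sum>i\<in>V. g * (u i * pderiv_mp i h))"
      unfolding u[symmetric] by (intro sum.cong) auto
    then have "1 = g * (\<Sum>i\<in>V. u i * pderiv_mp i h)" by (simp only: sum_distrib_left)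
    then show ?thesis by (rule dvdI)
  qed
  have "\<not> f + r dvd 1"
  proof
    assume "f + r dvd 1"
    then obtain q where "(f + r) * q = Const 1" by (auto simp: dvd_def)
    from pderiv_unit[OF this, of j] pdp[OF j(1)] j(2) show False by simp
  qed
  moreover have "g dvd 1 \<or> h dvd 1" if gh: "f + r = g * h" for g h
  proof -
    have hg: "f + r = h * g" using gh by (simp add: mult.commute)
    obtain w where w: "\<And>j. j \<in> V \<Longrightarrow> pderiv_mp j g = w * pderiv_mp j f"
      using gradient_of_factor[OF gh V u t] by blast
    obtain v where v: "\<And>j. j \<in> V \<Longrightarrow> pderiv_mp j h = v * pderiv_mp j f"
      using gradient_of_factor[OF hg V u t] by blast
    have "g \<noteq> 0" "h \<noteq> 0" using gh p0 by auto
    then have "degree (uni j f) = degree (uni j g) + degree (uni j h)"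
      using degp gh by (simp add: degree_uni_mult)
    \<comment> \<open>If both multipliers were nonzero, the positive degree of \<open>f\<close> in
      \<open>X_j\<close> would be at least its own double.\<close>
    then have "w = 0 \<or> v = 0" using big[OF w[OF j(1)]] big[OF v[OF j(1)]] degf by linarith
    then show ?thesis using unit[OF gh] unit[OF hg] w v by auto
  qed
  ultimately show ?thesis using p0 by (auto simp: irreducible_def)
qed

section \<open>Linear combinations of the components of the three maps\<close>

lemma sum_lessThan_2n: "(\<Sum>i<2 * n. f i) = (\<Sum>i<n. f i) + (\<Sum>i<n. f (n + i))"
  for f :: "nat \<Rightarrow> 'b::comm_monoid_add"
proof -
  have "(\<Sum>i<n + m. f i) = (\<Sum>i<n. f i) + (\<Sum>i<m. f (n + i))" for m
    by (induction m) (auto simp: add.assoc)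
  from this[of n] show ?thesis by (simp add: mult_2)
qed

lemma sum_lessThan_3n: "(\<Sum>i<3 * n. f i) = (\<Sum>i<n. f i) + (\<Sum>i<n. f (n + i)) + (\<Sum>i<n. f (2 * n + i))"
  for f :: "nat \<Rightarrow> 'b::comm_monoid_add"
proof -
  have "(\<Sum>i<2 * n + m. f i) = (\<Sum>i<2 * n. f i) + (\<Sum>i<m. f (2 * n + i))" for m
    by (induction m) (auto simp: add.assoc)
  from this[of n] show ?thesis by (simp add: sum_lessThan_2n[symmetric] numeral_3_eq_3 mult_2 add.assoc)
qed

text \<open>The Jacobian matrix times its adjugate is \<open>c\<close> times the identity, so column
  \<open>k\<close> of the adjugate pairs with row \<open>l\<close> to 0 unless \<open>l = k\<close>.
  Hence it pairs with the gradient of the combination to the nonzero constant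
  \<open>lam k * c\<close>, and scaling gives the coefficients \<open>u\<close>.\<close>

lemma keller_unimodular:
  fixes F :: "nat \<Rightarrow> 'a::field_char_0 mpoly"
  assumes "keller n F" "k < n" "lam k \<noteq> 0"
  obtains u where "(\<Sum>j<n. u j * pderiv_mp j (\<Sum>l<n. Const (lam l) * F l)) = 1"
proof -
  let ?J = "jacobian n F"
  obtain c where c: "c \<noteq> 0" "det ?J = Const c" using assms by (auto simp: keller_def)
  have J: "?J \<in> carrier_mat n n" by (simp add: jacobian_def)
  have e: "(\<Sum>j<n. pderiv_mp j (F l) * adj_mat ?J $$ (j, k)) = (if l = k then Const c else 0)" if "l < n" for l
  proof -
    have "(?J * adj_mat ?J) $$ (l, k) = (Const c \<cdot>\<^sub>m 1\<^sub>m n) $$ (l, k)" by (simp add: adj_mat(2)[OF J] c)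
    then show ?thesis
      using that assms(2) adj_mat(1)[OF J] J
      by (auto simp: scalar_prod_def jacobian_def atLeast0LessThan split: if_splits)
  qed
  have "(\<Sum>j<n. adj_mat ?J $$ (j, k) * pderiv_mp j (\<Sum>l<n. Const (lam l) * F l)) =
    (\<Sum>j<n. \<Sum>l<n. Const (lam l) * (pderiv_mp j (F l) * adj_mat ?J $$ (j, k)))"
    by (simp add: sum_distrib_left sum_distrib_right mult.assoc mult.left_commute mult.commute[of "adj_mat ?J $$ _"])
  also have "\<dots> = (\<Sum>l<n. Const (lam l) * (\<Sum>j<n. pderiv_mp j (F l) * adj_mat ?J $$ (j, k)))"
    by (subst sum.swap) (simp add: sum_distrib_left)
  also have "\<dots> = (\<Sum>l<n. if l = k then Const (lam k) * Const c else 0)"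
    by (intro sum.cong) (auto simp: e)
  also have "\<dots> = Const (lam k * c)" using assms(2) by (simp add: Const.hom_mult)
  finally have *: "(\<Sum>j<n. adj_mat ?J $$ (j, k) * pderiv_mp j (\<Sum>l<n. Const (lam l) * F l)) = Const (lam k * c)" .
  have "(\<Sum>j<n. (Const (inverse (lam k * c)) * adj_mat ?J $$ (j, k)) * pderiv_mp j (\<Sum>l<n. Const (lam l) * F l)) =
    Const (inverse (lam k * c)) * Const (lam k * c)"
    unfolding *[symmetric] sum_distrib_left mult.assoc ..
  also have "\<dots> = 1" using c assms(3) by (simp del: inverse_mult_distrib flip: Const.hom_mult)
  finally show ?thesis by (rule that)
qed

text \<open>Viewed in \<open>X_(n+k)\<close>, that is y_k, the part free of x has leading
  coefficient \<open>- lam k\<close> in degree \<open>d\<close>: the other powers do not involve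
  this variable and \<open>s\<close> has smaller degree. So the criterion for separated variables
  applies.\<close>

lemma irreducible_keller_comb:
  fixes F :: "nat \<Rightarrow> 'a::field_char_0 mpoly"
  assumes F: "keller n F" and k: "k < n" "lam k \<noteq> 0"
    and s: "vars s \<inter> {..<n} = {}" "degree (uni (n + k) s) < d"
  shows "irreducible ((\<Sum>l<n. Const (lam l) * (F l - Var (n + l) ^ d)) + s)"
proof -
  let ?f = "\<Sum>l<n. Const (lam l) * F l" and ?t = "n + k"
  let ?q = "s - (\<Sum>l\<in>{..<n} - {k}. Const (lam l) * Var (n + l) ^ d)"
  define r where "r = s - (\<Sum>l<n. Const (lam l) * Var (n + l) ^ d)"
  have eq: "(\<Sum>l<n. Const (lam l) * (F l - Var (n + l) ^ d)) + s = ?f + r"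
    by (simp add: r_def right_diff_distrib sum_subtractf)
  obtain u where u: "(\<Sum>j<n. u j * pderiv_mp j ?f) = 1" using keller_unimodular[OF F k(1), where lam=lam] k(2) by blast
  have term_vars: "vars (Const (lam l) * g :: 'a mpoly) \<subseteq> vars g" for l g
    using vars_mult[of "Const (lam l)" g] by simp
  have vf: "vars ?f \<subseteq> {..<n}"
    using vars_sum[of "\<lambda>l. Const (lam l) * F l" "{..<n}"] term_vars[of _ "F _"] F
    by (fastforce simp: keller_def polymap_def)
  have "vars (\<Sum>l<n. Const (lam l) * Var (n + l) ^ d :: 'a mpoly) \<subseteq> {n..}"
    using vars_sum[of "\<lambda>l. Const (lam l) * Var (n + l) ^ d :: 'a mpoly" "{..<n}"]
      term_vars[of _ "Var _ ^ d"] vars_power[of "Var _ :: 'a mpoly" d] by fastforce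
  then have vr: "vars r \<inter> {..<n} = {}"
    using vars_diff[of s "\<Sum>l<n. Const (lam l) * Var (n + l) ^ d"] s(1) unfolding r_def by fastforce
  have "r = Const (- lam k) * Var ?t ^ d + ?q"
    using k(1) by (simp add: r_def sum.remove[of "{..<n}" k] Const.hom_uminus)
  then have ur: "uni ?t r = monom (Const (- lam k)) d + uni ?t ?q"
    by (simp add: uni.hom_add uni.hom_mult uni.hom_power uni_Var monom_altdef)
  have "degree (uni ?t (\<Sum>l\<in>{..<n} - {k}. Const (lam l) * Var (n + l) ^ d) :: 'a mpoly poly) \<le> 0"
    unfolding uni.hom_sum
    by (intro degree_sum_le) (auto simp: uni.hom_mult uni.hom_power uni_Var poly_const_pow)
  then have "degree (uni ?t ?q) < d"
    using s(2) by (auto simp: uni.hom_minus intro!: degree_diff_less)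
  moreover have "degree (monom (Const (- lam k) :: 'a mpoly) d) = d" using k(2) by (simp add: degree_monom_eq)
  ultimately have "degree (uni ?t r) = d" "lead_coeff (uni ?t r) = Const (- lam k)"
    unfolding ur by (simp_all add: degree_add_eq_left coeff_eq_0)
  then show ?thesis
    unfolding eq using irreducible_separated[OF vf vr u, of ?t "- lam k"] s(2) k(2) by simp
qed

lemma irreducible_linear_form:
  fixes mu :: "nat \<Rightarrow> 'a::field_char_0"
  assumes "k < n" "mu k \<noteq> 0"
  shows "irreducible (Const c + (\<Sum>i<n. Const (mu i) * Var (g + i)))"
proof (rule irreducible_of_pderiv_Const[OF _ assms(2)])
  show "pderiv_mp (g + k) (Const c + (\<Sum>i<n. Const (mu i) * Var (g + i))) = Const (mu k)"
    using assms(1) by (simp add: pderiv_mp_Var if_distrib[where f="\<lambda>x. a * x" for a] cong: if_cong)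
qed

text \<open>The common core of the three cases, reached in (b) and (c) once the components linear in
  z have dropped out. Since \<open>d \<ge> 2\<close>, the linear form in y has too low a degree to
  disturb the \<open>d\<close>-th power of y_k, so every \<open>lam k\<close> must vanish; then only
  the linear form is left.\<close>

lemma lincomb_keller_linear:
  fixes F :: "nat \<Rightarrow> 'a::field_char_0 mpoly"
  assumes F: "keller n F" and d: "d \<ge> 2"
    and red: "\<not> irreducible (Const c + ((\<Sum>l<n. Const (lam l) * (F l - Var (n + l) ^ d)) + (\<Sum>i<n. Const (mu i) * Var (n + i))))"
      (is "\<not> irreducible ?p")
  shows "?p = Const c"
proof -
  let ?s = "Const c + (\<Sum>i<n. Const (mu i) * Var (n + i)) :: 'a mpoly"
  have "vars (\<Sum>i<n. Const (mu i) * Var (n + i) :: 'a mpoly) \<subseteq> {n..}"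
    using vars_sum[of "\<lambda>l. Const (mu l) * Var (n + l) :: 'a mpoly" "{..<n}"]
      vars_mult[of "Const _ :: 'a mpoly" "Var _"] by fastforce
  then have vs: "vars ?s \<inter> {..<n} = {}"
    using vars_add[of "Const c" "\<Sum>i<n. Const (mu i) * Var (n + i) :: 'a mpoly"] by fastforce
  have "degree (uni t ?s) \<le> 1" for t
    unfolding uni.hom_sum uni.hom_add
    by (intro degree_add_le degree_sum_le) (auto simp: uni.hom_mult uni_Var)
  then have ds: "degree (uni t ?s) < d" for t using d by (meson le_less_trans less_le_trans one_less_numeral_iff semiring_norm(76))
  have lam: "lam k = 0" if "k < n" for k
    using irreducible_keller_comb[OF F that _ vs ds, of lam] red by (auto simp: algebra_simps)
  then have eq: "?p = ?s" by simp
  have "mu k = 0" if "k < n" for k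
    using irreducible_linear_form[where mu=mu, OF that, of c n] red unfolding eq by auto
  then show ?thesis unfolding eq by simp
qed

lemma lincomb_G_a:
  fixes F :: "nat \<Rightarrow> 'a::field_char_0 mpoly"
  assumes F: "keller n F" and d: "d \<ge> 2"
  shows "lincomb_prop (2 * n) (G_a n d F)"
  unfolding lincomb_prop_def
proof (intro allI impI)
  fix c lam
  have eq: "Const c + (\<Sum>i<2 * n. Const (lam i) * G_a n d F i) = Const c + ((\<Sum>l<n. Const (lam l) * (F l - Var (n + l) ^ d)) + (\<Sum>i<n. Const (lam (n + i)) * Var (n + i)))"
    by (simp add: sum_lessThan_2n G_a_def)
  assume "\<not> irreducible (Const c + (\<Sum>i<2 * n. Const (lam i) * G_a n d F i))"
  then show "\<exists>a. Const c + (\<Sum>i<2 * n. Const (lam i) * G_a n d F i) = Const a"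
    unfolding eq using lincomb_keller_linear[OF F d, of c lam "\<lambda>i. lam (n + i)"] by blast
qed

lemma keller_pderiv_eq_0: "keller n F \<Longrightarrow> l < n \<Longrightarrow> j \<ge> n \<Longrightarrow> pderiv_mp j (F l) = 0"
  using pderiv_mp_not_vars[of j "F l"] by (fastforce simp: keller_def polymap_def)

text \<open>The variable z_k occurs only in component \<open>2 * n + k\<close>, linearly with
  coefficient 1, so a nonzero coefficient of this component gives a constant nonzero derivative.
  What remains is a combination as in (a).\<close>

lemma lincomb_G_b:
  fixes F :: "nat \<Rightarrow> 'a::field_char_0 mpoly"
  assumes F: "keller n F" and d: "d \<ge> 2"
  shows "lincomb_prop (3 * n) (G_b n d F)"
  unfolding lincomb_prop_def
proof (intro allI impI)
  fix c lam
  let ?p = "Const c + (\<Sum>i<3 * n. Const (lam i) * G_b n d F i)"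
  assume red: "\<not> irreducible ?p"
  have G: "G_b n d F (2 * n + i) = Var (2 * n + i) + Var (n + i) ^ d" for i
    by (simp add: G_b_def)
  have "lam (2 * n + k) = 0" if k: "k < n" for k
  proof (rule ccontr)
    assume "lam (2 * n + k) \<noteq> 0"
    moreover have "pderiv_mp (2 * n + k) ?p = Const (lam (2 * n + k))"
      using k by (simp add: sum_lessThan_3n G) (simp add: G_b_def keller_pderiv_eq_0[OF F] pderiv_mp_power pderiv_mp_Var if_distrib[where f="\<lambda>x. a * x" for a] cong: if_cong)
    ultimately show False using red irreducible_of_pderiv_Const by blast
  qed
  then have eq: "?p = Const c + ((\<Sum>l<n. Const (lam l) * (F l - Var (n + l) ^ d)) + (\<Sum>i<n. Const (lam (n + i)) * Var (n + i)))"
    by (simp add: sum_lessThan_3n) (simp add: G_b_def)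
  show "\<exists>a. ?p = Const a"
    using lincomb_keller_linear[OF F d red[unfolded eq]] eq by auto
qed

text \<open>Here z_k occurs only in component \<open>n + k\<close>, again linearly. Once these
  components drop out, the last block supplies the linear form in y, so
  \<open>lam (2 * n + i)\<close> takes the place of \<open>lam (n + i)\<close>.\<close>

lemma lincomb_G_c:
  fixes F :: "nat \<Rightarrow> 'a::field_char_0 mpoly"
  assumes F: "keller n F" and d: "d \<ge> 2"
  shows "lincomb_prop (3 * n) (G_c n d F)"
  unfolding lincomb_prop_def
proof (intro allI impI)
  fix c lam
  let ?p = "Const c + (\<Sum>i<3 * n. Const (lam i) * G_c n d F i)"
  assume red: "\<not> irreducible ?p"
  have G: "G_c n d F (n + i) = Var (2 * n + i) - of_nat d * Var i * Var (n + i) ^ (d - 1)"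
    "G_c n d F (2 * n + i) = Var (n + i)" if "i < n" for i
    using that by (simp_all add: G_c_def mult_2 add.assoc)
  have "lam (n + k) = 0" if k: "k < n" for k
  proof (rule ccontr)
    assume "lam (n + k) \<noteq> 0"
    moreover have "pderiv_mp (2 * n + k) ?p = Const (lam (n + k))"
      using k by (simp add: sum_lessThan_3n G)
       (simp add: G_c_def keller_pderiv_eq_0[OF F] pderiv_mp_power pderiv_mp_Var pderiv_mp_mult if_distrib[where f="\<lambda>x. a * x" for a] cong: if_cong)
    ultimately show False using red irreducible_of_pderiv_Const by blast
  qed
  then have eq: "?p = Const c + ((\<Sum>l<n. Const (lam l) * (F l - Var (n + l) ^ d)) + (\<Sum>i<n. Const (lam (2 * n + i)) * Var (n + i)))"
    by (simp add: sum_lessThan_3n G) (simp add: G_c_def)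
  show "\<exists>a. ?p = Const a"
    using lincomb_keller_linear[OF F d red[unfolded eq]] eq by auto
qed

section \<open>Keller and invertible maps under composition\<close>

lemma polymap_vars: "polymap m F \<Longrightarrow> i < m \<Longrightarrow> k \<in> vars (F i) \<Longrightarrow> k < m"
  by (auto simp: polymap_def)

lemma polymap_comp:
  assumes "polymap m F" "polymap m E"
  shows "polymap m (\<lambda>i. subst_mp E (F i))"
  unfolding polymap_def
proof (intro allI impI)
  fix i assume "i < m"
  then show "vars (subst_mp E (F i)) \<subseteq> {..<m}"
    using assms by (intro vars_subst) (meson lessThan_iff polymap_def subset_iff)
qed

lemma invertible_pmI:
  assumes "polymap m F" "polymap m H" "\<And>i. i < m \<Longrightarrow> subst_mp H (F i) = Var i" "\<And>i. i < m \<Longrightarrow> subst_mp F (H i) = Var i"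
  shows "invertible_pm m F"
  using assms by (auto simp: invertible_pm_def)

text \<open>A function on all of \<open>nat\<close> stands for a map in \<open>m\<close> variables,
  so only its first \<open>m\<close> values may matter; \<open>polymap\<close> guarantees
  this.\<close>

lemma subst_polymap_cong:
  assumes "polymap m F" "i < m" "\<And>k. k < m \<Longrightarrow> s k = t k"
  shows "subst_mp s (F i) = subst_mp t (F i)"
  using assms polymap_vars by (intro subst_cong) blast

lemma polymap_cong: "(\<And>i. i < m \<Longrightarrow> F i = G i) \<Longrightarrow> polymap m F = polymap m G"
  by (auto simp: polymap_def)

lemma invertible_pm_cong:
  assumes "\<And>i. i < m \<Longrightarrow> F i = G i"
  shows "invertible_pm m F \<longleftrightarrow> invertible_pm m G"
proof -
  have "invertible_pm m G" if eq: "\<And>i. i < m \<Longrightarrow> F i = G i" and inv: "invertible_pm m F" for F G :: "nat \<Rightarrow> 'a mpoly"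
  proof -
    obtain H where H: "polymap m F" "polymap m H" "\<And>i. i < m \<Longrightarrow> subst_mp H (F i) = Var i" "\<And>i. i < m \<Longrightarrow> subst_mp F (H i) = Var i"
      using inv by (auto simp: invertible_pm_def)
    show ?thesis
    proof (rule invertible_pmI[OF _ H(2)])
      show "polymap m G" using H(1) polymap_cong[of m F G, OF eq] by blast
      show "subst_mp H (G i) = Var i" if "i < m" for i using H(3)[OF that] eq[OF that] by simp
      show "subst_mp G (H i) = Var i" if "i < m" for i
        using H(4)[OF that] subst_polymap_cong[OF H(2) that eq] by simp
    qed
  qed
  from this[of F G] this[of G F] show ?thesis using assms by metis
qed

text \<open>\<open>\<lambda>i. subst_mp E (F i)\<close> applies \<open>E\<close> first and
  \<open>F\<close> second, so its inverse applies the inverse \<open>H\<close> of \<open>F\<close>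
  first and the inverse \<open>K\<close> of \<open>E\<close> second.\<close>

lemma invertible_comp:
  assumes "invertible_pm m F" "invertible_pm m E"
  shows "invertible_pm m (\<lambda>i. subst_mp E (F i))"
proof -
  obtain H where H: "polymap m F" "polymap m H" "\<And>i. i < m \<Longrightarrow> subst_mp H (F i) = Var i" "\<And>i. i < m \<Longrightarrow> subst_mp F (H i) = Var i"
    using assms(1) by (auto simp: invertible_pm_def)
  obtain K where K: "polymap m E" "polymap m K" "\<And>i. i < m \<Longrightarrow> subst_mp K (E i) = Var i" "\<And>i. i < m \<Longrightarrow> subst_mp E (K i) = Var i"
    using assms(2) by (auto simp: invertible_pm_def)
  show ?thesis
  proof (rule invertible_pmI[OF polymap_comp[OF H(1) K(1)] polymap_comp[OF K(2) H(2)]])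
    fix i assume i: "i < m"
    have "subst_mp (\<lambda>i. subst_mp H (K i)) (subst_mp E (F i)) = subst_mp (\<lambda>k. subst_mp H (subst_mp K (E k))) (F i)"
      by (simp add: subst_subst)
    also have "\<dots> = subst_mp H (F i)"
      by (rule subst_polymap_cong[OF H(1) i]) (simp add: K(3))
    finally show "subst_mp (\<lambda>i. subst_mp H (K i)) (subst_mp E (F i)) = Var i" using H(3) i by simp
    have "subst_mp (\<lambda>i. subst_mp E (F i)) (subst_mp H (K i)) = subst_mp (\<lambda>k. subst_mp E (subst_mp F (H k))) (K i)"
      by (simp add: subst_subst)
    also have "\<dots> = subst_mp E (K i)"
      by (rule subst_polymap_cong[OF K(2) i]) (simp add: H(4))
    finally show "subst_mp (\<lambda>i. subst_mp E (F i)) (subst_mp H (K i)) = Var i" using K(4) i by simp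
  qed
qed

lemma invertible_comp_right_iff:
  assumes E: "invertible_pm m E" and F: "polymap m F"
  shows "invertible_pm m (\<lambda>i. subst_mp E (F i)) \<longleftrightarrow> invertible_pm m F"
proof
  obtain K where K: "polymap m E" "polymap m K" "\<And>i. i < m \<Longrightarrow> subst_mp K (E i) = Var i" "\<And>i. i < m \<Longrightarrow> subst_mp E (K i) = Var i"
    using E by (auto simp: invertible_pm_def)
  assume "invertible_pm m (\<lambda>i. subst_mp E (F i))"
  then have "invertible_pm m (\<lambda>i. subst_mp K (subst_mp E (F i)))"
    by (rule invertible_comp) (use K in \<open>auto intro: invertible_pmI\<close>)
  moreover have "subst_mp K (subst_mp E (F i)) = F i" if "i < m" for i
    using subst_polymap_cong[OF F that, of "\<lambda>k. subst_mp K (E k)" Var] K(3) by (simp add: subst_subst)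
  ultimately show "invertible_pm m F" using invertible_pm_cong[of m "\<lambda>i. subst_mp K (subst_mp E (F i))" F] by simp
qed (rule invertible_comp[OF _ E])

lemma invertible_comp_left_iff:
  assumes E: "invertible_pm m E" and F: "polymap m F"
  shows "invertible_pm m (\<lambda>i. subst_mp F (E i)) \<longleftrightarrow> invertible_pm m F"
proof
  obtain K where K: "polymap m E" "polymap m K" "\<And>i. i < m \<Longrightarrow> subst_mp K (E i) = Var i" "\<And>i. i < m \<Longrightarrow> subst_mp E (K i) = Var i"
    using E by (auto simp: invertible_pm_def)
  have invK: "invertible_pm m K" by (rule invertible_pmI[of m K E]) (use K in auto)
  assume "invertible_pm m (\<lambda>i. subst_mp F (E i))"
  then have "invertible_pm m (\<lambda>i. subst_mp (\<lambda>i. subst_mp F (E i)) (K i))"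
    by (rule invertible_comp[OF invK])
  moreover have "subst_mp (\<lambda>i. subst_mp F (E i)) (K i) = F i" if "i < m" for i
    using K(4)[OF that] by (simp flip: subst_subst)
  ultimately show "invertible_pm m F" using invertible_pm_cong[of m "\<lambda>i. subst_mp (\<lambda>i. subst_mp F (E i)) (K i)" F] by simp
qed (rule invertible_comp[OF E])

lemma jacobian_comp:
  assumes "polymap m F"
  shows "jacobian m (\<lambda>i. subst_mp E (F i)) = map_mat (subst_mp E) (jacobian m F) * jacobian m E"
proof (rule eq_matI)
  fix i j assume "i < dim_row (map_mat (subst_mp E) (jacobian m F) * jacobian m E)" "j < dim_col (map_mat (subst_mp E) (jacobian m F) * jacobian m E)"
  then have ij: "i < m" "j < m" by (simp_all add: jacobian_def)
  then show "jacobian m (\<lambda>i. subst_mp E (F i)) $$ (i, j) = (map_mat (subst_mp E) (jacobian m F) * jacobian m E) $$ (i, j)"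
    using pderiv_mp_subst[of "F i" "{..<m}" j E] assms
    by (simp add: jacobian_def scalar_prod_def polymap_def atLeast0LessThan)
qed (auto simp: jacobian_def)

text \<open>The chain rule gives a product of matrices, and the ring homomorphism
  \<open>subst_mp E\<close> commutes with the determinant.\<close>

lemma det_jacobian_comp:
  assumes "polymap m F"
  shows "det (jacobian m (\<lambda>i. subst_mp E (F i))) = subst_mp E (det (jacobian m F)) * det (jacobian m E)"
  unfolding jacobian_comp[OF assms]
  by (subst det_mult[of _ m]) (auto simp: jacobian_def)

lemma keller_comp:
  assumes "keller m F" "keller m E"
  shows "keller m (\<lambda>i. subst_mp E (F i))"
  using assms polymap_comp[of m F E] det_jacobian_comp[of m F E]
  by (auto simp: keller_def simp flip: Const.hom_mult)

lemma jacobian_cong: "(\<And>i. i < m \<Longrightarrow> F i = G i) \<Longrightarrow> jacobian m F = jacobian m G"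
  by (auto simp: jacobian_def intro!: eq_matI)

lemma keller_cong: "(\<And>i. i < m \<Longrightarrow> F i = G i) \<Longrightarrow> keller m F = keller m G"
  using jacobian_cong[of m F G] polymap_cong[of m F G] by (auto simp: keller_def)

text \<open>The chain rule for the inverse after \<open>F\<close> makes the Jacobian determinant a
  divisor of 1, and the units of the polynomial ring are the nonzero constants.\<close>

lemma invertible_imp_keller:
  fixes F :: "nat \<Rightarrow> 'a::field_char_0 mpoly"
  assumes "invertible_pm m F"
  shows "keller m F"
proof -
  obtain H where H: "polymap m F" "polymap m H" "\<And>i. i < m \<Longrightarrow> subst_mp F (H i) = Var i"
    using assms by (auto simp: invertible_pm_def)
  have "jacobian m (\<lambda>i. subst_mp F (H i)) = jacobian m Var"
    by (rule jacobian_cong) (simp add: H(3))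
  also have "\<dots> = 1\<^sub>m m" by (auto simp: jacobian_def pderiv_mp_Var intro!: eq_matI)
  finally have "det (jacobian m F) * subst_mp F (det (jacobian m H)) = Const 1"
    using det_jacobian_comp[OF H(2), of F] by (simp add: mult.commute)
  from unit_imp_Const[OF this] H(1) show ?thesis by (auto simp: keller_def)
qed

section \<open>Extension of a map by the identity\<close>

text \<open>No target dimension is fixed, so the same function represents (F, y) in
  \<open>2 * n\<close> and (F, y, z) in \<open>3 * n\<close> variables.\<close>

definition extend_map :: "nat \<Rightarrow> (nat \<Rightarrow> 'a::comm_ring_1 mpoly) \<Rightarrow> nat \<Rightarrow> 'a mpoly" where
  "extend_map n F i = (if i < n then F i else Var i)"

lemma polymap_ext: "polymap n F \<Longrightarrow> n \<le> m \<Longrightarrow> polymap m (extend_map n F)"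
  by (auto simp: polymap_def extend_map_def subset_iff) (meson less_le_trans)

text \<open>\<open>F\<close> does not involve the new variables, so the Jacobian matrix is block
  diagonal with an identity block.\<close>

lemma det_jacobian_ext:
  fixes F :: "nat \<Rightarrow> 'a::field_char_0 mpoly"
  assumes "polymap n F"
  shows "det (jacobian (n + k) (extend_map n F)) = det (jacobian n F)"
proof -
  have "jacobian (n + k) (extend_map n F) = four_block_mat (jacobian n F) (0\<^sub>m n k) (0\<^sub>m k n) (1\<^sub>m k)"
  proof (rule eq_matI)
    fix i j
    assume "i < dim_row (four_block_mat (jacobian n F) (0\<^sub>m n k) (0\<^sub>m k n) (1\<^sub>m k))"
       "j < dim_col (four_block_mat (jacobian n F) (0\<^sub>m n k) (0\<^sub>m k n) (1\<^sub>m k))"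
    then have ij: "i < n + k" "j < n + k" by (simp_all add: jacobian_def)
    have "pderiv_mp j (F i) = 0" if "i < n" "j \<ge> n"
      using that polymap_vars[OF assms] by (intro pderiv_mp_not_vars) (meson not_le)
    then show "jacobian (n + k) (extend_map n F) $$ (i, j) = four_block_mat (jacobian n F) (0\<^sub>m n k) (0\<^sub>m k n) (1\<^sub>m k) $$ (i, j)"
      using ij by (auto simp: jacobian_def extend_map_def pderiv_mp_Var)
  qed (auto simp: jacobian_def)
  then show ?thesis
    using det_four_block_mat_upper_right_zero[of "jacobian n F" n "0\<^sub>m n k" k "0\<^sub>m k n" "1\<^sub>m k"]
    by (simp add: jacobian_def)
qed

lemma keller_ext:
  fixes F :: "nat \<Rightarrow> 'a::field_char_0 mpoly"
  assumes "keller n F" "n \<le> m"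
  shows "keller m (extend_map n F)"
  using assms det_jacobian_ext[of n F "m - n"] polymap_ext[of n F m] by (auto simp: keller_def)

lemma invertible_ext_iff:
  assumes F: "polymap n F" and m: "n \<le> m"
  shows "invertible_pm m (extend_map n F) \<longleftrightarrow> invertible_pm n F"
proof
  assume "invertible_pm n F"
  then obtain H where H: "polymap n F" "polymap n H" "\<And>i. i < n \<Longrightarrow> subst_mp H (F i) = Var i" "\<And>i. i < n \<Longrightarrow> subst_mp F (H i) = Var i"
    by (auto simp: invertible_pm_def)
  show "invertible_pm m (extend_map n F)"
  proof (rule invertible_pmI[OF polymap_ext[OF H(1) m] polymap_ext[OF H(2) m]])
    fix i
    show "subst_mp (extend_map n H) (extend_map n F i) = Var i"
      using subst_polymap_cong[OF H(1), of i "extend_map n H" H] H(3)[of i] by (auto simp: extend_map_def)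
    show "subst_mp (extend_map n F) (extend_map n H i) = Var i"
      using subst_polymap_cong[OF H(2), of i "extend_map n F" F] H(4)[of i] by (auto simp: extend_map_def)
  qed
next
  assume "invertible_pm m (extend_map n F)"
  then obtain H where H: "polymap m H" "\<And>i. i < m \<Longrightarrow> subst_mp H (extend_map n F i) = Var i" "\<And>i. i < m \<Longrightarrow> subst_mp (extend_map n F) (H i) = Var i"
    by (auto simp: invertible_pm_def)
  \<comment> \<open>An inverse of the extended map is restricted to the first \<open>n\<close>
    variables by setting all others to 0.\<close>
  define z :: "nat \<Rightarrow> 'a mpoly" where "z k = (if k < n then Var k else 0)" for k
  have zF: "subst_mp z (F i) = F i" if "i < n" for i
    using subst_polymap_cong[OF F that, of z Var] by (simp add: z_def)
  have pm: "polymap n (\<lambda>i. subst_mp z (H i))"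
    unfolding polymap_def by (intro allI impI vars_subst) (auto simp: z_def)
  show "invertible_pm n F"
  proof (rule invertible_pmI[OF F pm])
    fix i assume i: "i < n"
    have "subst_mp (\<lambda>i. subst_mp z (H i)) (F i) = subst_mp z (subst_mp H (extend_map n F i))"
      using i by (simp add: subst_subst extend_map_def)
    also have "\<dots> = Var i" using i m H(2)[of i] by (simp add: z_def)
    finally show "subst_mp (\<lambda>i. subst_mp z (H i)) (F i) = Var i" .
    \<comment> \<open>The two substitutions agree because \<open>z\<close> fixes the components of
      \<open>F\<close> and kills the remaining variables.\<close>
    have "subst_mp F (subst_mp z (H i)) = subst_mp z (subst_mp (extend_map n F) (H i))"
      unfolding subst_subst by (rule subst_cong) (auto simp: extend_map_def z_def zF)
    also have "\<dots> = Var i" using i m H(3)[of i] by (simp add: z_def)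
    finally show "subst_mp F (subst_mp z (H i)) = Var i" .
  qed
qed

section \<open>Automorphisms behind the three constructions\<close>

lemma vars_subsetI_add: "vars p \<subseteq> S \<Longrightarrow> vars q \<subseteq> S \<Longrightarrow> vars (p + q) \<subseteq> S"
  using vars_add[of p q] by blast

lemma vars_subsetI_diff: "vars p \<subseteq> S \<Longrightarrow> vars q \<subseteq> S \<Longrightarrow> vars (p - q) \<subseteq> S"
  using vars_diff[of p q] by blast

lemma vars_subsetI_mult: "vars p \<subseteq> S \<Longrightarrow> vars q \<subseteq> S \<Longrightarrow> vars (p * q) \<subseteq> S"
  using vars_mult[of p q] by blast

lemma vars_subsetI_power: "vars p \<subseteq> S \<Longrightarrow> vars (p ^ k) \<subseteq> S"
  using vars_power[of p k] by blast

lemma vars_of_nat [simp]: "vars (of_nat k) = {}"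
  using vars_Const[of "of_nat k"] by (simp del: vars_Const add: Const_def)

lemmas vars_subsetI = vars_subsetI_add vars_subsetI_diff vars_subsetI_mult vars_subsetI_power

lemmas subst_hom = subst.hom_add subst.hom_minus subst.hom_mult subst.hom_power subst.hom_of_nat

text \<open>At the identity map the construction is the elementary automorphism (x - y^{*d}, y),
  whose inverse adds the powers back.\<close>

lemma invertible_G_a_Var: "invertible_pm (2 * n) (G_a n d Var :: nat \<Rightarrow> 'a::comm_ring_1 mpoly)"
proof (rule invertible_pmI)
  let ?H = "\<lambda>i. if i < n then Var i + Var (n + i) ^ d else Var i :: 'a mpoly"
  show "polymap (2 * n) (G_a n d Var :: nat \<Rightarrow> 'a mpoly)"
    by (simp only: polymap_def G_a_def split: if_split, intro allI impI conjI vars_subsetI) auto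
  show "polymap (2 * n) ?H"
    by (simp only: polymap_def split: if_split, intro allI impI conjI vars_subsetI) auto
  show "subst_mp ?H (G_a n d Var i) = Var i" for i by (simp add: G_a_def subst_hom)
  show "subst_mp (G_a n d Var) (?H i) = Var i" for i by (simp add: G_a_def subst_hom)
qed

lemma invertible_G_b_Var: "invertible_pm (3 * n) (G_b n d Var :: nat \<Rightarrow> 'a::comm_ring_1 mpoly)"
proof (rule invertible_pmI)
  let ?H = "\<lambda>i. if i < n then Var i + Var (n + i) ^ d else if i < 2 * n then Var i else Var i - Var (i - n) ^ d :: 'a mpoly"
  show "polymap (3 * n) (G_b n d Var :: nat \<Rightarrow> 'a mpoly)"
    by (simp only: polymap_def G_b_def split: if_split, intro allI impI conjI vars_subsetI) auto
  show "polymap (3 * n) ?H"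
    by (simp only: polymap_def split: if_split, intro allI impI conjI vars_subsetI) auto
  show "subst_mp ?H (G_b n d Var i) = Var i" if "i < 3 * n" for i using that by (auto simp: G_b_def subst_hom)
  show "subst_mp (G_b n d Var) (?H i) = Var i" if "i < 3 * n" for i using that by (auto simp: G_b_def subst_hom)
qed

text \<open>The map (c) is the composite of \<open>shear_map\<close>, \<open>(F, y, z)\<close> and
  \<open>swap_map\<close>, applied in this order.\<close>

definition swap_map :: "nat \<Rightarrow> nat \<Rightarrow> nat \<Rightarrow> 'a::comm_ring_1 mpoly" where
  "swap_map n d i = (if i < n then Var i - Var (n + i) ^ d else if i < 2 * n then Var (n + i) else Var (i - n))"

definition shear_map :: "nat \<Rightarrow> 'a::comm_ring_1 mpoly \<Rightarrow> nat \<Rightarrow> nat \<Rightarrow> 'a mpoly" where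
  "shear_map n c d i = (if i < 2 * n then Var i else Var i - c * Var (i - 2 * n) * Var (i - n) ^ (d - 1))"

lemma invertible_swap_map: "invertible_pm (3 * n) (swap_map n d :: nat \<Rightarrow> 'a::comm_ring_1 mpoly)"
proof (rule invertible_pmI)
  \<comment> \<open>The swap has moved y into the last block, so the power to be added back is that
    of \<open>Var (2 * n + i)\<close>.\<close>
  let ?H = "\<lambda>i. if i < n then Var i + Var (2 * n + i) ^ d else if i < 2 * n then Var (n + i) else Var (i - n) :: 'a mpoly"
  show "polymap (3 * n) (swap_map n d :: nat \<Rightarrow> 'a mpoly)"
    by (simp only: polymap_def swap_map_def split: if_split, intro allI impI conjI vars_subsetI) auto
  show "polymap (3 * n) ?H"
    by (simp only: polymap_def split: if_split, intro allI impI conjI vars_subsetI) auto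
  show "subst_mp ?H (swap_map n d i) = Var i" if "i < 3 * n" for i using that by (auto simp: swap_map_def subst_hom mult_2 add.assoc)
  show "subst_mp (swap_map n d) (?H i) = Var i" if "i < 3 * n" for i using that by (auto simp: swap_map_def subst_hom mult_2 add.assoc)
qed

text \<open>The shear fixes x and y and subtracts from z a polynomial in them, so the opposite
  coefficient gives the inverse.\<close>

lemma invertible_shear_map: "invertible_pm (3 * n) (shear_map n (of_nat c) d :: nat \<Rightarrow> 'a::comm_ring_1 mpoly)"
proof (rule invertible_pmI)
  have pm: "polymap (3 * n) (shear_map n b d :: nat \<Rightarrow> 'a mpoly)" if "vars b = {}" for b
    using that by (simp only: polymap_def shear_map_def split: if_split, intro allI impI conjI vars_subsetI) auto
  show "polymap (3 * n) (shear_map n (of_nat c) d :: nat \<Rightarrow> 'a mpoly)"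
    "polymap (3 * n) (shear_map n (- of_nat c) d :: nat \<Rightarrow> 'a mpoly)" by (rule pm; simp)+
  show "subst_mp (shear_map n (- of_nat c) d) (shear_map n (of_nat c) d i) = Var i" if "i < 3 * n" for i
    using that by (auto simp: shear_map_def subst_hom)
  show "subst_mp (shear_map n (of_nat c) d) (shear_map n (- of_nat c) d i) = Var i" if "i < 3 * n" for i
    using that by (auto simp: shear_map_def subst_hom subst.hom_uminus)
qed

text \<open>The map is the automorphism \<open>G_a n d Var\<close> applied after
  \<open>extend_map n F\<close>, so both claims reduce to composition and extension.\<close>

lemma keller_invertible_G_a:
  fixes F :: "nat \<Rightarrow> 'a::field_char_0 mpoly"
  assumes F: "keller n F"
  shows "keller (2 * n) (G_a n d F)" "invertible_pm n F \<longleftrightarrow> invertible_pm (2 * n) (G_a n d F)"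
proof -
  have G: "G_a n d F = (\<lambda>i. subst_mp (extend_map n F) (G_a n d Var i))"
    by (rule ext) (auto simp: G_a_def extend_map_def subst_hom)
  have pm: "polymap n F" using F by (simp add: keller_def)
  show "keller (2 * n) (G_a n d F)"
    unfolding G by (rule keller_comp[OF invertible_imp_keller[OF invertible_G_a_Var] keller_ext[OF F]]) simp
  show "invertible_pm n F \<longleftrightarrow> invertible_pm (2 * n) (G_a n d F)"
    unfolding G by (simp add: invertible_comp_left_iff[OF invertible_G_a_Var polymap_ext[OF pm]] invertible_ext_iff[OF pm])
qed

lemma keller_invertible_G_b:
  fixes F :: "nat \<Rightarrow> 'a::field_char_0 mpoly"
  assumes F: "keller n F"
  shows "keller (3 * n) (G_b n d F)" "invertible_pm n F \<longleftrightarrow> invertible_pm (3 * n) (G_b n d F)"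
proof -
  have G: "G_b n d F = (\<lambda>i. subst_mp (extend_map n F) (G_b n d Var i))"
    by (rule ext) (auto simp: G_b_def extend_map_def subst_hom)
  have pm: "polymap n F" using F by (simp add: keller_def)
  show "keller (3 * n) (G_b n d F)"
    unfolding G by (rule keller_comp[OF invertible_imp_keller[OF invertible_G_b_Var] keller_ext[OF F]]) simp
  show "invertible_pm n F \<longleftrightarrow> invertible_pm (3 * n) (G_b n d F)"
    unfolding G by (simp add: invertible_comp_left_iff[OF invertible_G_b_Var polymap_ext[OF pm]] invertible_ext_iff[OF pm])
qed

lemma keller_invertible_G_c:
  fixes F :: "nat \<Rightarrow> 'a::field_char_0 mpoly"
  assumes F: "keller n F"
  shows "keller (3 * n) (G_c n d F)" "invertible_pm n F \<longleftrightarrow> invertible_pm (3 * n) (G_c n d F)"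
proof -
  let ?E = "shear_map n (of_nat d) d :: nat \<Rightarrow> 'a mpoly"
  have pm: "polymap n F" using F by (simp add: keller_def)
  \<comment> \<open>\<open>F\<close> depends on x alone, and the shear fixes x.\<close>
  have EF: "subst_mp ?E (F i) = F i" if "i < n" for i
    using subst_polymap_cong[OF pm that, of ?E Var] by (simp add: shear_map_def)
  have G: "G_c n d F i = subst_mp ?E (subst_mp (extend_map n F) (swap_map n d i))" if "i < 3 * n" for i
    using that by (auto simp: G_c_def extend_map_def swap_map_def shear_map_def subst_hom EF)
  have pm': "polymap (3 * n) (extend_map n F)" by (rule polymap_ext[OF pm]) simp
  have sw: "polymap (3 * n) (swap_map n d :: nat \<Rightarrow> 'a mpoly)"
    using invertible_swap_map by (auto simp: invertible_pm_def)
  have "keller (3 * n) (\<lambda>i. subst_mp (extend_map n F) (swap_map n d i))"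
    by (rule keller_comp[OF invertible_imp_keller[OF invertible_swap_map] keller_ext[OF F]]) simp
  from keller_comp[OF this invertible_imp_keller[OF invertible_shear_map]]
  show "keller (3 * n) (G_c n d F)" using keller_cong[of "3 * n" "G_c n d F", OF G] by blast
  show "invertible_pm n F \<longleftrightarrow> invertible_pm (3 * n) (G_c n d F)"
  proof -
    have "invertible_pm (3 * n) (G_c n d F) \<longleftrightarrow> invertible_pm (3 * n) (\<lambda>i. subst_mp ?E (subst_mp (extend_map n F) (swap_map n d i)))"
      by (rule invertible_pm_cong) (rule G)
    then show ?thesis
      by (simp add: invertible_comp_right_iff[OF invertible_shear_map polymap_comp[OF sw pm']]
          invertible_comp_left_iff[OF invertible_swap_map pm'] invertible_ext_iff[OF pm])
  qed
qed

section \<open>Symmetry and conjugation\<close>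

text \<open>In each block only the summand with the matching index \<open>k\<close> contributes to
  the derivative. This form makes the symmetry of the Jacobian matrix visible.\<close>

lemma G_c_gradient:
  fixes F :: "nat \<Rightarrow> 'a::comm_ring_1 mpoly"
  assumes "i < 3 * n"
  shows "G_c n d F i = (if i < n then F i else 0) +
    pderiv_mp i (\<Sum>k<n. Var (n + k) * Var (2 * n + k) - Var k * Var (n + k) ^ d)"
proof -
  consider "i < n" | k where "i = n + k" "k < n" | k where "i = 2 * n + k" "k < n"
  proof -
    have "i < n \<or> (i = n + (i - n) \<and> i - n < n) \<or> (i = 2 * n + (i - 2 * n) \<and> i - 2 * n < n)" using assms by linarith
    then show ?thesis using that by blast
  qed
  then show ?thesis
  proof cases
    case 1
    have "pderiv_mp i (\<Sum>k<n. Var (n + k) * Var (2 * n + k) - Var k * Var (n + k) ^ d) =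
      (\<Sum>k<n. if k = i then - (Var (n + i) ^ d) else 0 :: 'a mpoly)"
      using 1 unfolding pderiv_mp_sum by (intro sum.cong) (auto simp: pderiv_mp_mult pderiv_mp_power pderiv_mp_Var)
    then show ?thesis using 1 by (simp add: G_c_def)
  next
    case (2 k)
    have "pderiv_mp i (\<Sum>k<n. Var (n + k) * Var (2 * n + k) - Var k * Var (n + k) ^ d) =
      (\<Sum>l<n. if l = k then Var (2 * n + k) - of_nat d * Var k * Var (n + k) ^ (d - 1) else 0 :: 'a mpoly)"
      using 2 unfolding pderiv_mp_sum by (intro sum.cong) (auto simp: pderiv_mp_mult pderiv_mp_power pderiv_mp_Var ac_simps)
    then show ?thesis using 2 by (simp add: G_c_def mult_2 add.assoc)
  next
    case (3 k)
    have "pderiv_mp i (\<Sum>k<n. Var (n + k) * Var (2 * n + k) - Var k * Var (n + k) ^ d) =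
      (\<Sum>l<n. if l = k then Var (n + k) else 0 :: 'a mpoly)"
      using 3 unfolding pderiv_mp_sum by (intro sum.cong) (auto simp: pderiv_mp_mult pderiv_mp_power pderiv_mp_Var)
    then show ?thesis using 3 by (simp add: G_c_def)
  qed
qed

text \<open>The gradient part contributes a Hessian matrix, symmetric since partial derivatives
  commute; the rest is the Jacobian matrix of \<open>F\<close> in the x-block and zero
  elsewhere.\<close>

lemma jacobian_G_c_symmetric:
  fixes F :: "nat \<Rightarrow> 'a::comm_ring_1 mpoly"
  assumes F: "polymap n F" and sym: "transpose_mat (jacobian n F) = jacobian n F"
  shows "transpose_mat (jacobian (3 * n) (G_c n d F)) = jacobian (3 * n) (G_c n d F)"
proof -
  have F0: "pderiv_mp j (F i) = 0" if "i < n" "\<not> j < n" for i j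
    using that F by (intro pderiv_mp_not_vars) (auto simp: polymap_def)
  have Fs: "pderiv_mp j (F i) = pderiv_mp i (F j)" if "i < n" "j < n" for i j
    using arg_cong[OF sym, of "\<lambda>A. A $$ (j, i)"] that by (simp add: jacobian_def)
  have "pderiv_mp j (G_c n d F i) = pderiv_mp i (G_c n d F j)" if "i < 3 * n" "j < 3 * n" for i j
    unfolding G_c_gradient[OF that(1)] G_c_gradient[OF that(2)] pderiv_mp_add
    by (subst pderiv_mp_commute) (auto simp: F0 Fs simp del: pderiv_mp_sum pderiv_mp_diff)
  then show ?thesis by (auto simp: jacobian_def intro!: eq_matI)
qed


section \<open>Conjugation of the map (b) to a power linear map\<close>

lemma lessThan_3n_cases:
  assumes "i < 3 * (n::nat)"
  obtains "i < n" | k where "i = n + k" "k < n" | k where "i = 2 * n + k" "k < n"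
proof -
  have "i < n \<or> (i = n + (i - n) \<and> i - n < n) \<or> (i = 2 * n + (i - 2 * n) \<and> i - 2 * n < n)" using assms by linarith
  then show ?thesis using that by blast
qed

text \<open>The identity M(X - TZ) = MX - (MT)Z in coordinates. With \<open>M = Ti\<close> it
  identifies the new change of coordinates, with \<open>M = A\<close> it computes the new power
  linear map.\<close>

lemma linear_shift:
  assumes "M \<in> carrier_mat n n" "T \<in> carrier_mat n n" "i < n"
  shows "(\<Sum>j<n. Const (M $$ (i, j)) * (X j - (\<Sum>m<n. Const (T $$ (j, m)) * Z m))) =
    (\<Sum>j<n. Const (M $$ (i, j)) * X j) - (\<Sum>m<n. Const ((M * T) $$ (i, m)) * Z m)"
proof -
  have "(\<Sum>m<n. Const ((M * T) $$ (i, m)) * Z m) = (\<Sum>m<n. \<Sum>j<n. Const (M $$ (i, j)) * (Const (T $$ (j, m)) * Z m))"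
    using assms by (intro sum.cong)
      (auto simp: scalar_prod_def Const.hom_sum Const.hom_mult sum_distrib_right atLeast0LessThan mult.assoc)
  also have "\<dots> = (\<Sum>j<n. Const (M $$ (i, j)) * (\<Sum>m<n. Const (T $$ (j, m)) * Z m))"
    by (subst sum.swap) (simp add: sum_distrib_left)
  finally show ?thesis by (simp add: right_diff_distrib sum_subtractf)
qed

text \<open>The z-block of (b) carries exactly the powers that are subtracted in the x-block, so a
  coordinate change that adds \<open>T\<close> times the z-block to the x-block removes
  them.\<close>

lemma power_linear_conj_G_b:
  fixes F :: "nat \<Rightarrow> 'a::field mpoly"
  assumes F: "polymap n F" and d: "d > 0"
    and P: "power_linear n d P" "lin_conj n (\<lambda>i. F i - Var i) P"
  shows "\<exists>P. power_linear (3 * n) d P \<and> lin_conj (3 * n) (\<lambda>i. G_b n d F i - Var i) P"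
proof -
  obtain A where A: "A \<in> carrier_mat n n" "\<And>i. i < n \<Longrightarrow> P i = (\<Sum>j<n. Const (A $$ (i, j)) * Var j) ^ d"
    using P(1) by (auto simp: power_linear_def)
  obtain T Ti where T: "T \<in> carrier_mat n n" and Ti: "Ti \<in> carrier_mat n n" and TTi: "T * Ti = 1\<^sub>m n" "Ti * T = 1\<^sub>m n"
    and PT: "\<And>i. i < n \<Longrightarrow> P i = (\<Sum>j<n. Const (T $$ (i, j)) *
          subst_mp (\<lambda>k. if k < n then (\<Sum>l<n. Const (Ti $$ (k, l)) * Var l) else Var k) (F j - Var j))"
    using P(2) unfolding lin_conj_def by blast
  define \<tau> :: "nat \<Rightarrow> 'a mpoly" where "\<tau> k = (if k < n then (\<Sum>l<n. Const (Ti $$ (k, l)) * Var l) else Var k)" for k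
  \<comment> \<open>\<open>\<tau>\<close> is the given change of coordinates; substituting
    \<open>\<rho>\<close> into it will give the new one, \<open>\<sigma>\<close>, on the
    x-block.\<close>
  define \<rho> :: "nat \<Rightarrow> 'a mpoly" where "\<rho> l = (if l < n then Var l - (\<Sum>m<n. Const (T $$ (l, m)) * Var (2 * n + m)) else Var l)" for l
  \<comment> \<open>The rows of blocks of \<open>B\<close> are (A, 0, -AT), (0, 0, 0) and (0, 1, 0);
    the last one produces the powers of y.\<close>
  define B where "B = mat (3 * n) (3 * n) (\<lambda>(i, j). if i < n \<and> j < n then A $$ (i, j)
    else if i < n \<and> 2 * n \<le> j then - (A * T) $$ (i, j - 2 * n) else if 2 * n \<le> i \<and> i = n + j then 1 else 0)"
  \<comment> \<open>\<open>S\<close> sends (x, y, z) to (T(x + z), y, z), and \<open>Si\<close>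
    sends (x, y, z) to (Ti x - z, y, z).\<close>
  define S where "S = mat (3 * n) (3 * n) (\<lambda>(i, j). if i < n \<and> j < n then T $$ (i, j)
    else if i < n \<and> 2 * n \<le> j then T $$ (i, j - 2 * n) else if i = j then 1 else 0)"
  define Si where "Si = mat (3 * n) (3 * n) (\<lambda>(i, j). if i < n \<and> j < n then Ti $$ (i, j)
    else if i = j then 1 else if j = 2 * n + i then - 1 else 0)"
  define \<sigma> :: "nat \<Rightarrow> 'a mpoly" where "\<sigma> k = (if k < 3 * n then (\<Sum>l<3 * n. Const (Si $$ (k, l)) * Var l) else Var k)" for k
  define Q :: "nat \<Rightarrow> 'a mpoly" where "Q i = (\<Sum>j<3 * n. Const (B $$ (i, j)) * Var j) ^ d" for i
  have carrier: "B \<in> carrier_mat (3 * n) (3 * n)" "S \<in> carrier_mat (3 * n) (3 * n)" "Si \<in> carrier_mat (3 * n) (3 * n)"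
    by (simp_all add: B_def S_def Si_def)
  have TTi': "(\<Sum>k<n. T $$ (i, k) * Ti $$ (k, j)) = (if i = j then 1 else 0)" if "i < n" "j < n" for i j
    using arg_cong[OF TTi(1), of "\<lambda>A. A $$ (i, j)"] that T Ti by (simp add: scalar_prod_def atLeast0LessThan)
  have "S * Si = 1\<^sub>m (3 * n)"
  proof (rule eq_matI)
    fix i j assume "i < dim_row (1\<^sub>m (3 * n))" "j < dim_col (1\<^sub>m (3 * n))"
    then have ij: "i < 3 * n" "j < 3 * n" by simp_all
    then have "(S * Si) $$ (i, j) = (\<Sum>k<3 * n. S $$ (i, k) * Si $$ (k, j))"
      using carrier by (simp add: scalar_prod_def atLeast0LessThan)
    also have "\<dots> = (if i = j then 1 else 0)"
      using ij(1)
    proof (cases rule: lessThan_3n_cases)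
      case 1
      from ij(2) show ?thesis
        by (cases rule: lessThan_3n_cases)
          (use 1 in \<open>auto simp: S_def Si_def sum_lessThan_3n TTi' if_distrib[where f="\<lambda>x. a * x" for a] sum.delta sum.delta' cong: if_cong\<close>)
    next
      case (2 k)
      from ij(2) show ?thesis
        by (cases rule: lessThan_3n_cases)
          (use 2 in \<open>auto simp: S_def Si_def sum_lessThan_3n if_distrib[where f="\<lambda>x. x * a" for a] sum.delta sum.delta' cong: if_cong\<close>)
    next
      case (3 k)
      from ij(2) show ?thesis
        by (cases rule: lessThan_3n_cases)
          (use 3 in \<open>auto simp: S_def Si_def sum_lessThan_3n if_distrib[where f="\<lambda>x. x * a" for a] sum.delta sum.delta' cong: if_cong\<close>)
    qed
    finally show "(S * Si) $$ (i, j) = 1\<^sub>m (3 * n) $$ (i, j)" using ij by simp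
  qed (simp_all add: S_def Si_def)
  \<comment> \<open>For square matrices a one-sided inverse is two-sided.\<close>
  then have inv: "S * Si = 1\<^sub>m (3 * n)" "Si * S = 1\<^sub>m (3 * n)"
    using mat_mult_left_right_inverse[OF carrier(2,3)] by simp_all
  have \<sigma>: "\<sigma> k = \<tau> k - Var (2 * n + k)" if "k < n" for k
    using that by (simp add: \<sigma>_def \<tau>_def Si_def sum_lessThan_3n if_distrib[where f="\<lambda>x. Const x * a" for a] Const.hom_uminus cong: if_cong)
  have \<sigma>2: "\<sigma> (n + k) = Var (n + k)" "\<sigma> (2 * n + k) = Var (2 * n + k)" if "k < n" for k
    using that by (simp_all add: \<sigma>_def Si_def sum_lessThan_3n if_distrib[where f="\<lambda>x. Const x * a" for a] cong: if_cong)
  have \<rho>\<tau>: "subst_mp \<rho> (\<tau> k) = \<sigma> k" if k: "k < n" for k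
  proof -
    have "subst_mp \<rho> (\<tau> k) = (\<Sum>l<n. Const (Ti $$ (k, l)) * (Var l - (\<Sum>m<n. Const (T $$ (l, m)) * Var (2 * n + m))))"
      using k by (simp add: \<tau>_def subst.hom_sum subst.hom_mult \<rho>_def)
    also have "\<dots> = \<tau> k - (\<Sum>m<n. Const (1\<^sub>m n $$ (k, m)) * Var (2 * n + m))"
      unfolding linear_shift[OF Ti T k] TTi using k by (simp add: \<tau>_def)
    also have "(\<Sum>m<n. Const (1\<^sub>m n $$ (k, m)) * Var (2 * n + m)) = (\<Sum>m<n. if m = k then Var (2 * n + k) else 0 :: 'a mpoly)"
      using k by (intro sum.cong) auto
    finally show ?thesis using k by (simp add: \<sigma>)
  qed
  \<comment> \<open>\<open>F - x\<close> involves only x, where \<open>\<sigma>\<close> is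
    \<open>\<tau>\<close> followed by the substitution \<open>\<rho>\<close>.\<close>
  have F\<sigma>: "subst_mp \<sigma> (F j - Var j) = subst_mp \<rho> (subst_mp \<tau> (F j - Var j))" if "j < n" for j
  proof -
    have "vars (F j - Var j) \<subseteq> {..<n}"
      using F that vars_diff[of "F j" "Var j"] by (auto simp: polymap_def)
    then show ?thesis unfolding subst_subst by (intro subst_cong) (auto simp: \<rho>\<tau>)
  qed
  have G: "G_b n d F (n + j) = Var (n + j)" "G_b n d F (2 * n + j) = Var (2 * n + j) + Var (n + j) ^ d" if "j < n" for j
    using that by (simp_all add: G_b_def)
  have conj: "Q i = (\<Sum>j<3 * n. Const (S $$ (i, j)) * subst_mp \<sigma> (G_b n d F j - Var j))" if "i < 3 * n" for i
    using that
  proof (cases rule: lessThan_3n_cases)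
    case 1
    \<comment> \<open>Row \<open>i\<close> of \<open>S\<close> also picks up \<open>T\<close> times
      the powers of y from the z-block, which cancel those subtracted from \<open>F\<close>.\<close>
    have "(\<Sum>j<3 * n. Const (S $$ (i, j)) * subst_mp \<sigma> (G_b n d F j - Var j)) =
      (\<Sum>j<n. Const (T $$ (i, j)) * (subst_mp \<sigma> (F j - Var j) - Var (n + j) ^ d)) + (\<Sum>j<n. Const (T $$ (i, j)) * Var (n + j) ^ d)"
      using 1 by (simp add: sum_lessThan_3n G S_def) (simp add: G_b_def subst.hom_minus subst.hom_add subst.hom_power \<sigma>2 \<sigma>2(1)[unfolded add.commute[of n]] algebra_simps)
    also have "\<dots> = (\<Sum>j<n. Const (T $$ (i, j)) * subst_mp \<sigma> (F j - Var j))"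
      by (simp add: right_diff_distrib sum_subtractf)
    also have "\<dots> = subst_mp \<rho> (\<Sum>j<n. Const (T $$ (i, j)) * subst_mp \<tau> (F j - Var j))"
      by (simp add: subst.hom_sum subst.hom_mult F\<sigma>)
    also have "\<dots> = subst_mp \<rho> (P i)" using PT[OF 1] by (simp add: \<tau>_def[abs_def])
    also have "\<dots> = (\<Sum>j<n. Const (A $$ (i, j)) * (Var j - (\<Sum>m<n. Const (T $$ (j, m)) * Var (2 * n + m)))) ^ d"
      using A(2)[OF 1] by (simp add: subst.hom_power subst.hom_sum subst.hom_mult \<rho>_def)
    also have "\<dots> = Q i"
      unfolding linear_shift[OF A(1) T 1] Q_def using 1 by (simp add: sum_lessThan_3n B_def Const.hom_uminus sum_negf)
    finally show ?thesis ..
  next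
    \<comment> \<open>The middle rows of \<open>B\<close> are zero, and \<open>d > 0\<close> makes
      the \<open>d\<close>-th power of the zero form vanish.\<close>
    case (2 k)
    then show ?thesis using d
      by (simp add: Q_def B_def S_def sum_lessThan_3n G)
  next
    case (3 k)
    then show ?thesis
      by (simp add: Q_def B_def S_def sum_lessThan_3n G subst.hom_power \<sigma>2 if_distrib[where f="\<lambda>x. Const x * a" for a] cong: if_cong)
  qed
  have "power_linear (3 * n) d Q" using carrier(1) by (auto simp: power_linear_def Q_def)
  moreover have "lin_conj (3 * n) (\<lambda>i. G_b n d F i - Var i) Q"
    unfolding lin_conj_def using carrier inv conj[unfolded \<sigma>_def[abs_def]] by blast
  ultimately show ?thesis by blast
qed

theorem theorem3p2:
  fixes n d :: nat and F :: "nat \<Rightarrow> 'a::field_char_0 mpoly"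
  assumes "keller n F" and "d \<ge> 2"
  shows "(lincomb_prop (2 * n) (G_a n d F) \<and> keller (2 * n) (G_a n d F) \<and>
            (invertible_pm n F \<longleftrightarrow> invertible_pm (2 * n) (G_a n d F)))
       \<and> (lincomb_prop (3 * n) (G_b n d F) \<and> keller (3 * n) (G_b n d F) \<and>
            (invertible_pm n F \<longleftrightarrow> invertible_pm (3 * n) (G_b n d F)))
       \<and> (lincomb_prop (3 * n) (G_c n d F) \<and> keller (3 * n) (G_c n d F) \<and>
            (invertible_pm n F \<longleftrightarrow> invertible_pm (3 * n) (G_c n d F)))
       \<and> (\<forall>i<3 * n. G_c n d F i = (if i < n then F i else 0) +
            pderiv_mp i (\<Sum>k<n. Var (n + k) * Var (2 * n + k) - Var k * Var (n + k) ^ d))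
       \<and> ((\<exists>P. power_linear n d P \<and> lin_conj n (\<lambda>i. F i - Var i) P) \<longrightarrow>
            (\<exists>P. power_linear (3 * n) d P \<and> lin_conj (3 * n) (\<lambda>i. G_b n d F i - Var i) P))
       \<and> (transpose_mat (jacobian n F) = jacobian n F \<longrightarrow>
            transpose_mat (jacobian (3 * n) (G_c n d F)) = jacobian (3 * n) (G_c n d F))"
proof -
  have F: "polymap n F" using assms(1) by (simp add: keller_def)
  have "d > 0" using assms(2) by simp
  then show ?thesis
    using lincomb_G_a[OF assms] lincomb_G_b[OF assms] lincomb_G_c[OF assms]
      keller_invertible_G_a[OF assms(1)] keller_invertible_G_b[OF assms(1)] keller_invertible_G_c[OF assms(1)]
      G_c_gradient[of _ n d F] power_linear_conj_G_b[OF F] jacobian_G_c_symmetric[OF F]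
    by blast
qed

end
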